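(* Let $G=G_1\ast_A G_2$ be an amalgam of finite groups and let $g,h_1,\dots,h_n\in G$. Then there exists an algorithm which decides whether or not $g$ belongs to the subgroup $H=\langle h_1,\dots,h_n\rangle$ of $G$.
   Context: $G_1=gp\langle X_1|R_1\rangle$ and $G_2=gp\langle X_2|R_2\rangle$ are finite groups given by finite presentations with $X_1^{\pm}\cap X_2^{\pm}=\emptyset$, $A$ is a finite group with monomorphisms $\phi_i:A\to G_i$ ($i=1,2$), and $G=gp\langle X_1,X_2\mid R_1,R_2,\phi_1(A)=\phi_2(A)\rangle$. The groups $G_1,G_2,A$, the amalgam, and the Cayley graphs and all relative Cayley graphs of $G_1$ and $G_2$ are given (not part of the input). The input consists of words $g,h_1,\dots,h_n$ in the letters $(X_1\cup X_2)^{\pm}$ representing elements of $G$; the algorithm must work for all such inputs. *)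

theory Defs
  imports "HOL-Algebra.Generated_Groups" "HOL-Library.Nat_Bijection"
begin

section \<open>Words and presented groups\<close>

text \<open>The letter \<open>(x, True)\<close> stands for the generator \<open>x\<close> and \<open>(x, False)\<close> for its
  formal inverse. Words are not assumed to be reduced.\<close>

type_synonym 'x letter = "'x \<times> bool"
type_synonym 'x word = "'x letter list"

definition signed :: "'x set \<Rightarrow> 'x letter set"
  where "signed X = X \<times> UNIV"

definition words :: "'x set \<Rightarrow> 'x word set"
  where "words X = lists (signed X)"

definition inv_letter :: "'x letter \<Rightarrow> 'x letter"
  where "inv_letter l = (fst l, \<not> snd l)"

definition inv_word :: "'x word \<Rightarrow> 'x word"
  where "inv_word w = rev (map inv_letter w)"

inductive pres_eq :: "'x set \<Rightarrow> 'x word set \<Rightarrow> 'x word \<Rightarrow> 'x word \<Rightarrow> bool"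
  for X R where
  refl: "w \<in> words X \<Longrightarrow> pres_eq X R w w"
| sym: "pres_eq X R u v \<Longrightarrow> pres_eq X R v u"
| trans: "pres_eq X R u v \<Longrightarrow> pres_eq X R v w \<Longrightarrow> pres_eq X R u w"
| cancel: "u \<in> words X \<Longrightarrow> v \<in> words X \<Longrightarrow> l \<in> signed X \<Longrightarrow>
    pres_eq X R (u @ [l, inv_letter l] @ v) (u @ v)"
| relator: "u \<in> words X \<Longrightarrow> v \<in> words X \<Longrightarrow> r \<in> R \<Longrightarrow> pres_eq X R (u @ r @ v) (u @ v)"

definition pres_rel :: "'x set \<Rightarrow> 'x word set \<Rightarrow> ('x word \<times> 'x word) set"
  where "pres_rel X R = {(u, v). pres_eq X R u v}"

definition word_class :: "'x set \<Rightarrow> 'x word set \<Rightarrow> 'x word \<Rightarrow> 'x word set"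
  where "word_class X R w = pres_rel X R `` {w}"

text \<open>The group \<open>gp\<langle>X | R\<rangle>\<close>, where \<open>R\<close> is a set of relators in \<^term>\<open>words X\<close>. Its elements are
  the classes of words modulo \<^const>\<open>pres_eq\<close>.\<close>

definition gp :: "'x set \<Rightarrow> 'x word set \<Rightarrow> 'x word set monoid"
  where "gp X R = \<lparr>carrier = words X // pres_rel X R,
    monoid.mult = (\<lambda>P Q. pres_rel X R `` {u @ v | u v. u \<in> P \<and> v \<in> Q}),
    one = word_class X R []\<rparr>"

text \<open>Relators of \<open>gp\<langle>X\<^sub>1, X\<^sub>2 | R\<^sub>1, R\<^sub>2, \<phi>\<^sub>1(A) = \<phi>\<^sub>2(A)\<rangle>\<close>. The values \<open>\<phi>\<^sub>1 a\<close> and \<open>\<phi>\<^sub>2 a\<close>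
  are classes of words, and the relation \<open>\<phi>\<^sub>1 a = \<phi>\<^sub>2 a\<close> is imposed for all choices of
  representatives; modulo \<open>R\<^sub>1\<close> and \<open>R\<^sub>2\<close> one choice would do.\<close>

definition amalgam_relators ::
  "'x word set \<Rightarrow> 'x word set \<Rightarrow> ('a, 'm) monoid_scheme \<Rightarrow>
    ('a \<Rightarrow> 'x word set) \<Rightarrow> ('a \<Rightarrow> 'x word set) \<Rightarrow> 'x word set"
  where "amalgam_relators R\<^sub>1 R\<^sub>2 A \<phi>\<^sub>1 \<phi>\<^sub>2 =
    R\<^sub>1 \<union> R\<^sub>2 \<union> {u @ inv_word v | a u v. a \<in> carrier A \<and> u \<in> \<phi>\<^sub>1 a \<and> v \<in> \<phi>\<^sub>2 a}"

lemma words_append [simp]: "u @ v \<in> words X \<longleftrightarrow> u \<in> words X \<and> v \<in> words X"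
  by (auto simp: words_def)

lemma words_Nil [simp]: "[] \<in> words X"
  by (simp add: words_def)

lemma inv_letter_signed [simp]: "inv_letter l \<in> signed X \<longleftrightarrow> l \<in> signed X"
  by (cases l) (simp add: signed_def inv_letter_def)

lemma inv_letter_inv_letter [simp]: "inv_letter (inv_letter l) = l"
  by (simp add: inv_letter_def)

lemma inv_word_in_words: "w \<in> words X \<Longrightarrow> inv_word w \<in> words X"
  by (auto simp: words_def inv_word_def in_lists_conv_set)

lemma pres_eq_words:
  assumes "pres_eq X R u v" and "R \<subseteq> words X"
  shows "u \<in> words X \<and> v \<in> words X"
  using assms by induction (auto simp: words_def)

lemma equiv_pres_rel:
  assumes "R \<subseteq> words X"
  shows "equiv (words X) (pres_rel X R)"
proof (rule equivI)
  show "pres_rel X R \<subseteq> words X \<times> words X"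
    using pres_eq_words[OF _ assms] by (auto simp: pres_rel_def)
  show "refl_on (words X) (pres_rel X R)"
    by (simp add: pres_rel_def refl_on_def pres_eq.refl)
  show "sym (pres_rel X R)"
    by (simp add: pres_rel_def sym_def pres_eq.sym)
  show "trans (pres_rel X R)"
    unfolding pres_rel_def trans_def by (blast intro: pres_eq.trans)
qed

lemma pres_eq_context:
  assumes "pres_eq X R u v" and "p \<in> words X" and "q \<in> words X"
  shows "pres_eq X R (p @ u @ q) (p @ v @ q)"
  using assms
proof (induction rule: pres_eq.induct)
  case (refl w)
  then show ?case by (simp add: pres_eq.refl)
next
  case (sym u v)
  then show ?case by (simp add: pres_eq.sym)
next
  case (trans u v w)
  then show ?case using pres_eq.trans by blast
next
  case (cancel u v l)
  then show ?case using pres_eq.cancel[of "p @ u" X "v @ q" l R] by simp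
next
  case (relator u v r)
  then show ?case using pres_eq.relator[of "p @ u" X "v @ q" r R] by simp
qed

lemma pres_eq_append:
  assumes "pres_eq X R u u'" and "pres_eq X R v v'" and R: "R \<subseteq> words X"
  shows "pres_eq X R (u @ v) (u' @ v')"
proof (rule pres_eq.trans)
  show "pres_eq X R (u @ v) (u' @ v)"
    using pres_eq_context[OF assms(1), of "[]" v] pres_eq_words[OF assms(2) R] by simp
  show "pres_eq X R (u' @ v) (u' @ v')"
    using pres_eq_context[OF assms(2), of u' "[]"] pres_eq_words[OF assms(1) R] by simp
qed

lemma pres_eq_right_inverse: "w \<in> words X \<Longrightarrow> pres_eq X R (w @ inv_word w) []"
proof (induction w)
  case Nil
  then show ?case by (simp add: inv_word_def pres_eq.refl)
next
  case (Cons l w)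
  then have l: "[l] \<in> words X" "l \<in> signed X" and w: "w \<in> words X" by (auto simp: words_def)
  have "[inv_letter l] \<in> words X" using l by (simp add: words_def)
  with Cons.IH[OF w] l(1)
  have "pres_eq X R ([l] @ (w @ inv_word w) @ [inv_letter l]) ([l] @ [] @ [inv_letter l])"
    by (rule pres_eq_context)
  moreover have "pres_eq X R ([l] @ [inv_letter l]) []"
    using pres_eq.cancel[of "[]" X "[]" l R] l(2) by simp
  ultimately have "pres_eq X R ([l] @ (w @ inv_word w) @ [inv_letter l]) []"
    using pres_eq.trans by simp blast
  then show ?case by (simp add: inv_word_def)
qed

lemma inv_word_inv_word [simp]: "inv_word (inv_word w) = w"
  by (simp add: inv_word_def rev_map comp_def)

lemma word_class_mult:
  assumes R: "R \<subseteq> words X" and "u \<in> words X" and "v \<in> words X"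
  shows "word_class X R u \<otimes>\<^bsub>gp X R\<^esub> word_class X R v = word_class X R (u @ v)"
proof -
  let ?S = "{u' @ v' | u' v'. u' \<in> word_class X R u \<and> v' \<in> word_class X R v}"
  have refl: "pres_eq X R u u" "pres_eq X R v v" using assms by (simp_all add: pres_eq.refl)
  have "w \<in> pres_rel X R `` ?S \<longleftrightarrow> w \<in> word_class X R (u @ v)" for w
  proof
    assume "w \<in> pres_rel X R `` ?S"
    then obtain u' v' where "pres_eq X R u u'" "pres_eq X R v v'" and w: "pres_eq X R (u' @ v') w"
      unfolding word_class_def pres_rel_def by blast
    then have "pres_eq X R (u @ v) (u' @ v')" using R by (simp add: pres_eq_append)
    then have "pres_eq X R (u @ v) w" using w by (rule pres_eq.trans)
    then show "w \<in> word_class X R (u @ v)" by (simp add: word_class_def pres_rel_def)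
  next
    assume "w \<in> word_class X R (u @ v)"
    then show "w \<in> pres_rel X R `` ?S"
      using refl unfolding word_class_def pres_rel_def by blast
  qed
  then show ?thesis by (auto simp: gp_def)
qed

lemma word_class_eq_iff:
  assumes "R \<subseteq> words X" and "u \<in> words X" and "v \<in> words X"
  shows "word_class X R u = word_class X R v \<longleftrightarrow> pres_eq X R u v"
  using eq_equiv_class_iff[OF equiv_pres_rel[OF assms(1)] assms(2,3)]
  by (simp add: word_class_def pres_rel_def)

lemma carrier_gp: "carrier (gp X R) = word_class X R ` words X"
  by (auto simp: gp_def quotient_def word_class_def)

lemma one_gp: "\<one>\<^bsub>gp X R\<^esub> = word_class X R []"
  by (simp add: gp_def)

theorem group_gp:
  assumes R: "R \<subseteq> words X"
  shows "group (gp X R)"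
proof (rule groupI)
  fix x assume "x \<in> carrier (gp X R)"
  then obtain w where w: "w \<in> words X" "x = word_class X R w" by (auto simp: carrier_gp)
  have iw: "inv_word w \<in> words X" using w(1) by (rule inv_word_in_words)
  have "word_class X R (inv_word w @ w) = word_class X R []"
    using pres_eq_right_inverse[OF iw] w(1) iw by (simp add: word_class_eq_iff[OF R])
  then show "\<exists>y\<in>carrier (gp X R). y \<otimes>\<^bsub>gp X R\<^esub> x = \<one>\<^bsub>gp X R\<^esub>"
    using w iw by (auto simp: carrier_gp one_gp word_class_mult[OF R])
qed (auto simp: carrier_gp one_gp word_class_mult[OF R])

theorem group_gp_amalgam:
  assumes "R\<^sub>1 \<subseteq> words X\<^sub>1" and "R\<^sub>2 \<subseteq> words X\<^sub>2"
    and "\<phi>\<^sub>1 \<in> mon A (gp X\<^sub>1 R\<^sub>1)" and "\<phi>\<^sub>2 \<in> mon A (gp X\<^sub>2 R\<^sub>2)"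
  shows "group (gp (X\<^sub>1 \<union> X\<^sub>2) (amalgam_relators R\<^sub>1 R\<^sub>2 A \<phi>\<^sub>1 \<phi>\<^sub>2))"
proof (rule group_gp)
  have mono: "w \<in> words (X\<^sub>1 \<union> X\<^sub>2)" if "w \<in> words X\<^sub>1 \<or> w \<in> words X\<^sub>2" for w
    using that by (auto simp: words_def signed_def in_lists_conv_set)
  have sub: "w \<in> words X" if "\<phi> \<in> mon A (gp X R)" "R \<subseteq> words X" "a \<in> carrier A" "w \<in> \<phi> a"
    for \<phi> R w a and X :: "'a set"
  proof -
    have "\<phi> a \<in> carrier (gp X R)" using that by (auto simp: mon_def hom_def)
    then show ?thesis
      using that pres_eq_words[OF _ that(2)]
      by (auto simp: carrier_gp word_class_def pres_rel_def)
  qed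
  show "amalgam_relators R\<^sub>1 R\<^sub>2 A \<phi>\<^sub>1 \<phi>\<^sub>2 \<subseteq> words (X\<^sub>1 \<union> X\<^sub>2)"
    using assms mono sub[OF assms(3,1)] sub[OF assms(4,2)]
    by (auto simp: amalgam_relators_def intro!: inv_word_in_words)
qed

section \<open>Algorithms\<close>

text \<open>Algorithms are programs for partial recursive functions on the natural numbers;
  \<open>evals p xs y\<close> means that \<open>p\<close> halts on the arguments \<open>xs\<close> with output \<open>y\<close>.\<close>

datatype recf = Zero | Succ | Proj nat | Comp recf "recf list" | PrimRec recf recf | Mu recf

inductive evals :: "recf \<Rightarrow> nat list \<Rightarrow> nat \<Rightarrow> bool" where
  Zero: "evals Zero xs 0"
| Succ: "evals Succ [x] (Suc x)"
| Proj: "i < length xs \<Longrightarrow> evals (Proj i) xs (xs ! i)"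
| Comp: "length ys = length ps \<Longrightarrow> (\<forall>i<length ps. evals (ps ! i) xs (ys ! i)) \<Longrightarrow>
    evals p ys z \<Longrightarrow> evals (Comp p ps) xs z"
| PrimRec_0: "evals p xs y \<Longrightarrow> evals (PrimRec p q) (0 # xs) y"
| PrimRec_Suc: "evals (PrimRec p q) (n # xs) y \<Longrightarrow> evals q (n # y # xs) z \<Longrightarrow>
    evals (PrimRec p q) (Suc n # xs) z"
| Mu: "evals p (n # xs) 0 \<Longrightarrow> (\<forall>m<n. \<exists>k. evals p (m # xs) (Suc k)) \<Longrightarrow> evals (Mu p) xs n"

inductive_cases evals_ZeroE: "evals Zero xs y"
inductive_cases evals_SuccE: "evals Succ xs y"
inductive_cases evals_ProjE: "evals (Proj i) xs y"
inductive_cases evals_CompE: "evals (Comp p ps) xs y"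
inductive_cases evals_PrimRec_0E: "evals (PrimRec p q) (0 # xs) y"
inductive_cases evals_PrimRec_SucE: "evals (PrimRec p q) (Suc n # xs) y"
inductive_cases evals_MuE: "evals (Mu p) xs y"

theorem evals_deterministic: "evals p xs y \<Longrightarrow> evals p xs z \<Longrightarrow> y = z"
proof (induction arbitrary: z rule: evals.induct)
  case (Zero xs)
  then show ?case by (rule evals_ZeroE) simp
next
  case (Succ x)
  then show ?case by (rule evals_SuccE) simp
next
  case (Proj i xs)
  from Proj.prems show ?case by (rule evals_ProjE) simp
next
  case (Comp ys ps xs p y)
  from Comp.prems obtain ys' where ys': "length ys' = length ps"
    "\<forall>i<length ps. evals (ps ! i) xs (ys' ! i)" "evals p ys' z"
    by (rule evals_CompE)
  have "ys = ys'"
  proof (rule nth_equalityI)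
    show "length ys = length ys'" using Comp.hyps ys'(1) by simp
    show "ys ! i = ys' ! i" if "i < length ys" for i
      using that Comp.hyps Comp.IH(1) ys'(2) by simp
  qed
  then show ?case using Comp.IH(2) ys'(3) by simp
next
  case (PrimRec_0 p xs y q)
  from PrimRec_0.prems have "evals p xs z" by (rule evals_PrimRec_0E)
  then show ?case by (rule PrimRec_0.IH)
next
  case (PrimRec_Suc p q n xs y y')
  from PrimRec_Suc.prems obtain r where "evals (PrimRec p q) (n # xs) r" "evals q (n # r # xs) z"
    by (rule evals_PrimRec_SucE)
  then show ?case using PrimRec_Suc.IH by blast
next
  case (Mu p n xs)
  from Mu.prems have "evals p (z # xs) 0 \<and> (\<forall>m<z. \<exists>k. evals p (m # xs) (Suc k))"
    by (rule evals_MuE) simp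
  then have a: "evals p (z # xs) 0" and b: "\<forall>m<z. \<exists>k. evals p (m # xs) (Suc k)"
    by simp_all
  have "\<not> n < z"
  proof
    assume "n < z"
    then obtain k where "evals p (n # xs) (Suc k)" using b by blast
    then show False using Mu.IH(1) by blast
  qed
  moreover have "\<not> z < n"
  proof
    assume "z < n"
    then obtain k where "\<forall>y. evals p (z # xs) y \<longrightarrow> Suc k = y" using Mu.IH(2) by blast
    then show False using a by blast
  qed
  ultimately show ?case by simp
qed

text \<open>The program only has to be correct on codes of inputs in \<open>D\<close>.\<close>

definition decides :: "recf \<Rightarrow> ('i \<Rightarrow> nat) \<Rightarrow> 'i set \<Rightarrow> ('i \<Rightarrow> bool) \<Rightarrow> bool"
  where "decides p code D P \<longleftrightarrow> (\<forall>x\<in>D. evals p [code x] (if P x then 1 else 0))"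

text \<open>Codes of letters, words and inputs \<open>(g, [h\<^sub>1, \<dots>, h\<^sub>n])\<close>, relative to a numbering \<open>\<nu>\<close> of the
  generators.\<close>

definition letter_code :: "('x \<Rightarrow> nat) \<Rightarrow> 'x letter \<Rightarrow> nat"
  where "letter_code \<nu> l = prod_encode (\<nu> (fst l), of_bool (snd l))"

definition word_code :: "('x \<Rightarrow> nat) \<Rightarrow> 'x word \<Rightarrow> nat"
  where "word_code \<nu> w = list_encode (map (letter_code \<nu>) w)"

definition input_code :: "('x \<Rightarrow> nat) \<Rightarrow> 'x word \<times> 'x word list \<Rightarrow> nat"
  where "input_code \<nu> = (\<lambda>(g, hs). prod_encode (word_code \<nu> g, list_encode (map (word_code \<nu>) hs)))"

end

theory Submission
  imports Defs
begin

text \<open>Let \<open>G\<close> be the amalgamated product and \<open>H = \<langle>h\<^sub>1, \<dots>, h\<^sub>n\<rangle>\<close>. An action of \<open>G\<close> on a finite set in which every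
\<open>h\<^sub>i\<close> fixes a point that \<open>g\<close> moves shows that \<open>g\<close> is not in \<open>H\<close>, because stabilizers are subgroups
(\<open>letter_action_generate\<close>). The key fact is the converse with a bound: if \<open>g\<close> is not in \<open>H\<close>, then such an
action exists on a set whose size is bounded by an explicit function of the number and lengths of the words
(\<open>separating_letter_action\<close>). Membership is therefore decided by trying all actions of the letters on sets
of at most that size, and testing finitely many relators for each of them.

The bounded action comes from the action of \<open>G\<close> on the right cosets of \<open>H\<close>. Only the finite set \<open>F\<close> of cosets
that are visited while the input words are read matters. The theorem \<open>finite_amalgam_action\<close> embeds any
finite piece of an action of \<open>G\<close> into a finite one. An action of \<open>G\<close> is a pair of actions of \<open>G\<^sub>1\<close> and \<open>G\<^sub>2\<close>
that agree on \<open>A\<close>, and two tricks produce such pairs. First, \<open>G\<^sub>1 \<times> G\<^sub>2\<close> carries an action of \<open>G\<close> in which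
both factors have trivial point stabilizers (\<open>exists_free_action\<close>); it yields a finite action of \<open>G\<close> on a
power set into which the points of \<open>F\<close> embed compatibly with \<open>G\<^sub>1\<close>, and also, by another map,
compatibly with \<open>G\<^sub>2\<close> (\<open>orbit_mark\<close>). Secondly, in two disjoint copies of this power set an involution that
commutes with \<open>A\<close> exchanges the two images of \<open>F\<close> (\<open>equivariant_swap\<close>); conjugation of the action of \<open>G\<^sub>2\<close>
by it makes a single map compatible with both factors.

The search is carried out by a program for a primitive recursive function. An action of the letters on
\<open>{0, \<dots>, m - 1}\<close> is coded by the digits of one number in base \<open>m\<close>, so all quantifiers of the condition
\<open>no_separating_table\<close> are bounded, and closure of the computable functions under bounded quantification
and under loops over coded lists gives the program.\<close>

section \<open>Finite actions of amalgamated products\<close>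

definition right_action :: "('g, 'm) monoid_scheme \<Rightarrow> 's set \<Rightarrow> ('s \<Rightarrow> 'g \<Rightarrow> 's) \<Rightarrow> bool"
  where "right_action G S f \<longleftrightarrow>
    (\<forall>x\<in>S. \<forall>g\<in>carrier G. f x g \<in> S) \<and> (\<forall>x\<in>S. f x \<one>\<^bsub>G\<^esub> = x) \<and>
    (\<forall>x\<in>S. \<forall>g\<in>carrier G. \<forall>h\<in>carrier G. f x (g \<otimes>\<^bsub>G\<^esub> h) = f (f x g) h)"

lemma right_actionD:
  assumes "right_action G S f" and "x \<in> S"
  shows "g \<in> carrier G \<Longrightarrow> f x g \<in> S" and "f x \<one>\<^bsub>G\<^esub> = x"
    and "g \<in> carrier G \<Longrightarrow> h \<in> carrier G \<Longrightarrow> f x (g \<otimes>\<^bsub>G\<^esub> h) = f (f x g) h"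
  using assms by (auto simp: right_action_def)

lemma right_action_inv:
  assumes "group G" and "right_action G S f" and "x \<in> S" and "g \<in> carrier G"
  shows "f (f x g) (inv\<^bsub>G\<^esub> g) = x" and "f (f x (inv\<^bsub>G\<^esub> g)) g = x"
proof -
  have "inv\<^bsub>G\<^esub> g \<in> carrier G" using assms(1,4) by simp
  then show "f (f x g) (inv\<^bsub>G\<^esub> g) = x" and "f (f x (inv\<^bsub>G\<^esub> g)) g = x"
    using assms(1,4) right_actionD(2)[OF assms(2,3)]
    by (simp_all add: right_actionD(3)[OF assms(2,3), symmetric] group.r_inv group.l_inv)
qed

lemma right_action_conj:
  assumes "right_action G S f" and "\<And>x. x \<in> S \<Longrightarrow> \<tau> x \<in> S \<and> \<tau> (\<tau> x) = x"
  shows "right_action G S (\<lambda>x g. \<tau> (f (\<tau> x) g))"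
  using assms by (simp add: right_action_def)

lemma right_action_image:
  assumes "right_action G K f"
  shows "right_action G (Pow (U \<times> K)) (\<lambda>P g. (\<lambda>(y, k). (y, f k g)) ` P)"
  unfolding right_action_def
proof (intro conjI ballI)
  fix P g assume "P \<in> Pow (U \<times> K)" "g \<in> carrier G"
  then show "(\<lambda>(y, k). (y, f k g)) ` P \<in> Pow (U \<times> K)"
    using right_actionD(1)[OF assms] by auto
next
  fix P assume "P \<in> Pow (U \<times> K)"
  then have "(\<lambda>(y, k). (y, f k \<one>\<^bsub>G\<^esub>)) ` P = (\<lambda>p. p) ` P"
    using right_actionD(2)[OF assms] by (intro image_cong) auto
  then show "(\<lambda>(y, k). (y, f k \<one>\<^bsub>G\<^esub>)) ` P = P" by simp
next
  fix P g h assume "P \<in> Pow (U \<times> K)" "g \<in> carrier G" "h \<in> carrier G"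
  then show "(\<lambda>(y, k). (y, f k (g \<otimes>\<^bsub>G\<^esub> h))) ` P =
      (\<lambda>(y, k). (y, f k h)) ` (\<lambda>(y, k). (y, f k g)) ` P"
    unfolding image_image using right_actionD(3)[OF assms] by (intro image_cong) auto
qed

lemma right_action_bool:
  assumes "right_action G S f"
  shows "right_action G (UNIV \<times> S) (\<lambda>z g. (fst z, f (snd z) g))"
  using assms by (auto simp: right_action_def)

definition free_at :: "('g, 'm) monoid_scheme \<Rightarrow> ('s \<Rightarrow> 'g \<Rightarrow> 's) \<Rightarrow> 's \<Rightarrow> bool"
  where "free_at G f k \<longleftrightarrow> (\<forall>g\<in>carrier G. f k g = k \<longrightarrow> g = \<one>\<^bsub>G\<^esub>)"

text \<open>A choice of representatives \<open>t\<close> for the cosets \<open>g \<phi>(A)\<close>: every \<open>g\<close> is \<open>t g \<cdot> \<phi> (\<delta> g)\<close> for a unique \<open>\<delta> g\<close>,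
and \<open>\<delta>\<close> is a coordinate along the coset that right multiplication by \<open>\<phi> a\<close> shifts by \<open>a\<close>.\<close>

lemma mon_transversal:
  assumes G: "group G" and A: "group A" and \<phi>: "\<phi> \<in> mon A G"
  obtains t \<delta> where "\<And>g. g \<in> carrier G \<Longrightarrow> t g \<in> carrier G"
    and "\<And>g. g \<in> carrier G \<Longrightarrow> \<delta> g \<in> carrier A"
    and "\<And>g. g \<in> carrier G \<Longrightarrow> t g \<otimes>\<^bsub>G\<^esub> \<phi> (\<delta> g) = g"
    and "\<And>g a. g \<in> carrier G \<Longrightarrow> a \<in> carrier A \<Longrightarrow> t (t g \<otimes>\<^bsub>G\<^esub> \<phi> a) = t g"
    and "\<And>g a. g \<in> carrier G \<Longrightarrow> a \<in> carrier A \<Longrightarrow> \<delta> (t g \<otimes>\<^bsub>G\<^esub> \<phi> a) = a"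
proof -
  interpret G: group G by fact
  interpret A: group A by fact
  have hom: "\<phi> \<in> hom A G" and inj: "inj_on \<phi> (carrier A)" using \<phi> by (auto simp: mon_def)
  interpret \<phi>: group_hom A G \<phi> by (simp add: group_hom_def group_hom_axioms_def G A hom)
  define C where "C g = g <#\<^bsub>G\<^esub> (\<phi> ` carrier A)" for g
  define t where "t g = (SOME x. x \<in> C g)" for g
  have C_eq: "C x = C g" if "g \<in> carrier G" and "x \<in> C g" for g x
    unfolding C_def
    by (rule G.l_repr_independence[symmetric]) (use that \<phi>.img_is_subgroup in \<open>auto simp: C_def\<close>)
  have C_shift: "g \<otimes>\<^bsub>G\<^esub> \<phi> a \<in> C g" if "a \<in> carrier A" for g a
    using that by (auto simp: C_def l_coset_def)
  have t_C: "t g \<in> C g" for g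
    unfolding t_def using C_shift[OF A.one_closed] by (rule someI)
  have t_closed: "t g \<in> carrier G" if "g \<in> carrier G" for g
    using t_C[of g] that by (auto simp: C_def l_coset_def)
  have "\<exists>c. c \<in> carrier A \<and> t g \<otimes>\<^bsub>G\<^esub> \<phi> c = g" if g: "g \<in> carrier G" for g
  proof -
    obtain a where a: "a \<in> carrier A" "t g = g \<otimes>\<^bsub>G\<^esub> \<phi> a"
      using t_C[of g] by (auto simp: C_def l_coset_def)
    then have "t g \<otimes>\<^bsub>G\<^esub> \<phi> (inv\<^bsub>A\<^esub> a) = g" using g by (simp add: G.m_assoc)
    then show ?thesis using a(1) by (intro exI[of _ "inv\<^bsub>A\<^esub> a"]) simp
  qed
  then obtain \<delta> where \<delta>: "\<And>g. g \<in> carrier G \<Longrightarrow> \<delta> g \<in> carrier A"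
    "\<And>g. g \<in> carrier G \<Longrightarrow> t g \<otimes>\<^bsub>G\<^esub> \<phi> (\<delta> g) = g" by metis
  have t_shift: "t (t g \<otimes>\<^bsub>G\<^esub> \<phi> a) = t g" if g: "g \<in> carrier G" and a: "a \<in> carrier A" for g a
  proof -
    have "C (t g \<otimes>\<^bsub>G\<^esub> \<phi> a) = C (t g)" using C_shift[OF a] t_closed[OF g] by (rule C_eq[rotated])
    also have "\<dots> = C g" using g t_C by (rule C_eq)
    finally show ?thesis by (simp add: t_def)
  qed
  have "\<delta> (t g \<otimes>\<^bsub>G\<^esub> \<phi> a) = a" if g: "g \<in> carrier G" and a: "a \<in> carrier A" for g a
  proof -
    let ?h = "t g \<otimes>\<^bsub>G\<^esub> \<phi> a"
    have h: "?h \<in> carrier G" using t_closed[OF g] a by simp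
    have "t g \<otimes>\<^bsub>G\<^esub> \<phi> (\<delta> ?h) = t g \<otimes>\<^bsub>G\<^esub> \<phi> a" using \<delta>(2)[OF h] t_shift[OF g a] by simp
    then have "\<phi> (\<delta> ?h) = \<phi> a" using t_closed[OF g] \<delta>(1)[OF h] a by simp
    then show ?thesis using inj \<delta>(1)[OF h] a by (auto dest: inj_onD)
  qed
  with t_closed \<delta> t_shift show thesis by (rule that)
qed

lemma right_action_pullback:
  assumes "right_action G S f" and \<phi>: "\<phi> \<in> hom A G" and "group A" and "group G"
  shows "right_action A S (\<lambda>x a. f x (\<phi> a))"
  using assms(1) hom_in_carrier[OF \<phi>] hom_mult[OF \<phi>] hom_one[OF \<phi> assms(3,4)]
  by (simp add: right_action_def)

text \<open>Let \<open>k\<close> be a point with trivial stabilizer in a set \<open>K\<close> with an action \<open>\<kappa>\<close> of \<open>G\<close>. The points of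
\<open>I\<close> in a set with an arbitrary action of \<open>G\<close> then embed into the power set of \<open>I \<times> K\<close> with \<open>G\<close> acting on \<open>K\<close>
only: the point \<open>x\<close> goes to the graph that records through which \<open>u\<close> it is reached from each \<open>y\<close> in \<open>I\<close>, with \<open>u\<close>
represented by \<open>\<kappa> k u\<close>. The target depends on \<open>I\<close> and \<open>K\<close> only, not on the action that is embedded, so
actions of two different groups on the same points embed into the same power set.\<close>

definition orbit_mark ::
  "('g, 'm) monoid_scheme \<Rightarrow> ('s \<Rightarrow> 'g \<Rightarrow> 's) \<Rightarrow> 's set \<Rightarrow> ('k \<Rightarrow> 'g \<Rightarrow> 'k) \<Rightarrow> 'k \<Rightarrow> 's \<Rightarrow> ('s \<times> 'k) set"
  where "orbit_mark G f I \<kappa> k x = {(y, \<kappa> k u) | y u. y \<in> I \<and> u \<in> carrier G \<and> f y u = x}"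

lemma orbit_mark_in_Pow:
  "right_action G K \<kappa> \<Longrightarrow> k \<in> K \<Longrightarrow> orbit_mark G f I \<kappa> k x \<in> Pow (I \<times> K)"
  by (auto simp: orbit_mark_def right_actionD(1))

text \<open>The mark of \<open>x\<close> contains \<open>(x, k)\<close>, and as \<open>k\<close> has trivial stabilizer this pair can occur only in the
mark of \<open>x\<close>.\<close>

lemma orbit_mark_inj:
  assumes "group G" and f: "right_action G \<Omega> f" and \<kappa>: "right_action G K \<kappa>" and k: "k \<in> K"
    and free: "free_at G \<kappa> k" and I: "I \<subseteq> \<Omega>"
  shows "inj_on (orbit_mark G f I \<kappa> k) I"
proof (rule inj_onI)
  fix x y assume x: "x \<in> I" and "y \<in> I" and eq: "orbit_mark G f I \<kappa> k x = orbit_mark G f I \<kappa> k y"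
  interpret group G by fact
  have "(x, \<kappa> k \<one>\<^bsub>G\<^esub>) \<in> orbit_mark G f I \<kappa> k x"
    using x I right_actionD(2)[OF f, of x] by (auto simp: orbit_mark_def)
  then have "(x, k) \<in> orbit_mark G f I \<kappa> k y" using eq right_actionD(2)[OF \<kappa> k] by simp
  then obtain u where "u \<in> carrier G" "\<kappa> k u = k" "f x u = y" by (auto simp: orbit_mark_def)
  then show "x = y" using free x I right_actionD(2)[OF f, of x] by (auto simp: free_at_def)
qed

text \<open>If \<open>u\<close> moves \<open>y\<close> to \<open>x g\<close>, then \<open>u g\<^sup>-\<^sup>1\<close> moves \<open>y\<close> to \<open>x\<close>, so the marks correspond under
translation by \<open>g\<close>.\<close>

lemma orbit_mark_equivariant:
  assumes "group G" and f: "right_action G \<Omega> f" and \<kappa>: "right_action G K \<kappa>" and k: "k \<in> K"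
    and I: "I \<subseteq> \<Omega>" and x: "x \<in> \<Omega>" and g: "g \<in> carrier G"
  shows "orbit_mark G f I \<kappa> k (f x g) = (\<lambda>(y, l). (y, \<kappa> l g)) ` orbit_mark G f I \<kappa> k x"
proof
  interpret group G by fact
  show "orbit_mark G f I \<kappa> k (f x g) \<subseteq> (\<lambda>(y, l). (y, \<kappa> l g)) ` orbit_mark G f I \<kappa> k x"
  proof
    fix p assume "p \<in> orbit_mark G f I \<kappa> k (f x g)"
    then obtain y u where y: "y \<in> I" and u: "u \<in> carrier G" and yu: "f y u = f x g"
      and p: "p = (y, \<kappa> k u)" by (auto simp: orbit_mark_def)
    let ?v = "u \<otimes>\<^bsub>G\<^esub> inv\<^bsub>G\<^esub> g"
    have v: "?v \<in> carrier G" using u g by simp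
    have "f y ?v = f (f y u) (inv\<^bsub>G\<^esub> g)" using right_actionD(3)[OF f] y I u g by auto
    then have "f y ?v = x" using yu right_action_inv(1)[OF \<open>group G\<close> f x g] by simp
    then have "(y, \<kappa> k ?v) \<in> orbit_mark G f I \<kappa> k x" using y v by (auto simp: orbit_mark_def)
    moreover have "\<kappa> (\<kappa> k ?v) g = \<kappa> k u"
      using right_actionD(3)[OF \<kappa> k v g] u g by (simp add: m_assoc)
    ultimately show "p \<in> (\<lambda>(y, l). (y, \<kappa> l g)) ` orbit_mark G f I \<kappa> k x"
      unfolding p by (intro image_eqI[of _ _ "(y, \<kappa> k ?v)"]) auto
  qed
  show "(\<lambda>(y, l). (y, \<kappa> l g)) ` orbit_mark G f I \<kappa> k x \<subseteq> orbit_mark G f I \<kappa> k (f x g)"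
  proof
    fix p assume "p \<in> (\<lambda>(y, l). (y, \<kappa> l g)) ` orbit_mark G f I \<kappa> k x"
    then obtain y u where y: "y \<in> I" and u: "u \<in> carrier G" and yu: "f y u = x"
      and p: "p = (y, \<kappa> (\<kappa> k u) g)" by (auto simp: orbit_mark_def)
    have "p = (y, \<kappa> k (u \<otimes>\<^bsub>G\<^esub> g))" "f y (u \<otimes>\<^bsub>G\<^esub> g) = f x g"
      using p yu right_actionD(3)[OF \<kappa> k u g] right_actionD(3)[OF f _ u g] y I by auto
    then show "p \<in> orbit_mark G f I \<kappa> k (f x g)" using y u g by (auto simp: orbit_mark_def)
  qed
qed

text \<open>Two disjoint equivariant copies of the same set with an action can be exchanged by an equivariant
involution that fixes all other points: the copies are invariant, and so is what lies outside them.\<close>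

lemma equivariant_swap:
  assumes A: "group A" and b: "right_action A Z b" and c: "right_action A I c"
    and m: "inj_on m I" "m ` I \<subseteq> Z" "\<And>x a. x \<in> I \<Longrightarrow> a \<in> carrier A \<Longrightarrow> m (c x a) = b (m x) a"
    and n: "inj_on n I" "n ` I \<subseteq> Z" "\<And>x a. x \<in> I \<Longrightarrow> a \<in> carrier A \<Longrightarrow> n (c x a) = b (n x) a"
    and disj: "m ` I \<inter> n ` I = {}"
  obtains \<tau> where "\<And>z. z \<in> Z \<Longrightarrow> \<tau> z \<in> Z \<and> \<tau> (\<tau> z) = z"
    and "\<And>z a. z \<in> Z \<Longrightarrow> a \<in> carrier A \<Longrightarrow> \<tau> (b z a) = b (\<tau> z) a"
    and "\<And>x. x \<in> I \<Longrightarrow> \<tau> (m x) = n x" and "\<And>x. x \<in> I \<Longrightarrow> \<tau> (n x) = m x"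
proof -
  define \<tau> where "\<tau> z = (if z \<in> m ` I then n (inv_into I m z)
    else if z \<in> n ` I then m (inv_into I n z) else z)" for z
  have \<tau>_m: "\<tau> (m x) = n x" and \<tau>_n: "\<tau> (n x) = m x" if "x \<in> I" for x
    using that m(1) n(1) disj by (auto simp: \<tau>_def)
  have \<tau>_fix: "\<tau> z = z" if "z \<notin> m ` I" "z \<notin> n ` I" for z using that by (simp add: \<tau>_def)
  have cases: "z \<in> m ` I \<or> z \<in> n ` I \<or> z \<notin> m ` I \<and> z \<notin> n ` I" for z by blast
  have inv: "\<tau> z \<in> Z \<and> \<tau> (\<tau> z) = z" if "z \<in> Z" for z
    using cases[of z] that m(2) n(2) by (auto simp: \<tau>_m \<tau>_n \<tau>_fix)
  \<comment> \<open>Invariance of the two copies under inverses: a point that moves into a copy was in it before.\<close>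
  have preimage: "z \<in> k ` I" if z: "z \<in> Z" and a: "a \<in> carrier A" and ba: "b z a \<in> k ` I"
    and k: "\<And>x a. x \<in> I \<Longrightarrow> a \<in> carrier A \<Longrightarrow> k (c x a) = b (k x) a" for z a k
  proof -
    obtain x where x: "x \<in> I" "b z a = k x" using ba by blast
    have "z = b (k x) (inv\<^bsub>A\<^esub> a)" using right_action_inv(1)[OF A b z a] x(2) by simp
    also have "\<dots> = k (c x (inv\<^bsub>A\<^esub> a))" using k[OF x(1)] group.inv_closed[OF A a] by simp
    finally show ?thesis using right_actionD(1)[OF c x(1) group.inv_closed[OF A a]] by blast
  qed
  have "\<tau> (b z a) = b (\<tau> z) a" if z: "z \<in> Z" and a: "a \<in> carrier A" for z a
    using cases[of z]
  proof (elim disjE)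
    assume "z \<in> m ` I"
    then obtain x where x: "x \<in> I" "z = m x" by blast
    have "\<tau> (b z a) = \<tau> (m (c x a))" using x m(3) a by simp
    also have "\<dots> = b (\<tau> z) a" using x a n(3) right_actionD(1)[OF c] by (simp add: \<tau>_m)
    finally show ?thesis .
  next
    assume "z \<in> n ` I"
    then obtain x where x: "x \<in> I" "z = n x" by blast
    have "\<tau> (b z a) = \<tau> (n (c x a))" using x n(3) a by simp
    also have "\<dots> = b (\<tau> z) a" using x a m(3) right_actionD(1)[OF c] by (simp add: \<tau>_n)
    finally show ?thesis .
  next
    assume "z \<notin> m ` I \<and> z \<notin> n ` I"
    moreover from this have "b z a \<notin> m ` I" "b z a \<notin> n ` I"
      using preimage[OF z a _ m(3)] preimage[OF z a _ n(3)] by blast+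
    ultimately show ?thesis by (simp add: \<tau>_fix)
  qed
  with inv show thesis using \<tau>_m \<tau>_n by (rule that)
qed

text \<open>The amalgam as a diagram of groups. An action of the amalgamated product is a pair of actions of the
factors on the same set that agree on \<open>A\<close>.\<close>

locale amalgam =
  G1: group G1 + G2: group G2 + A: group A
  for G1 :: "('g, 'k) monoid_scheme" and G2 :: "('h, 'l) monoid_scheme"
    and A :: "('a, 'm) monoid_scheme" +
  fixes \<phi>1 :: "'a \<Rightarrow> 'g" and \<phi>2 :: "'a \<Rightarrow> 'h"
  assumes \<phi>1: "\<phi>1 \<in> mon A G1" and \<phi>2: "\<phi>2 \<in> mon A G2"
begin

lemma \<phi>1_closed [simp]: "a \<in> carrier A \<Longrightarrow> \<phi>1 a \<in> carrier G1"
  using \<phi>1 by (auto simp: mon_def hom_def)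

lemma \<phi>2_closed [simp]: "a \<in> carrier A \<Longrightarrow> \<phi>2 a \<in> carrier G2"
  using \<phi>2 by (auto simp: mon_def hom_def)

lemma \<phi>1_mult [simp]:
  "a \<in> carrier A \<Longrightarrow> b \<in> carrier A \<Longrightarrow> \<phi>1 (a \<otimes>\<^bsub>A\<^esub> b) = \<phi>1 a \<otimes>\<^bsub>G1\<^esub> \<phi>1 b"
  using \<phi>1 by (auto simp: mon_def hom_def)

lemma \<phi>2_mult [simp]:
  "a \<in> carrier A \<Longrightarrow> b \<in> carrier A \<Longrightarrow> \<phi>2 (a \<otimes>\<^bsub>A\<^esub> b) = \<phi>2 a \<otimes>\<^bsub>G2\<^esub> \<phi>2 b"
  using \<phi>2 by (auto simp: mon_def hom_def)

lemma \<phi>1_one [simp]: "\<phi>1 \<one>\<^bsub>A\<^esub> = \<one>\<^bsub>G1\<^esub>"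
  using \<phi>1 hom_one[OF _ A.is_group G1.is_group] by (auto simp: mon_def)

definition amalgam_action ::
  "'s set \<Rightarrow> ('s \<Rightarrow> 'g \<Rightarrow> 's) \<Rightarrow> ('s \<Rightarrow> 'h \<Rightarrow> 's) \<Rightarrow> bool"
  where "amalgam_action S f1 f2 \<longleftrightarrow> right_action G1 S f1 \<and> right_action G2 S f2 \<and>
    (\<forall>x\<in>S. \<forall>a\<in>carrier A. f1 x (\<phi>1 a) = f2 x (\<phi>2 a))"

text \<open>Two actions on a set, restricted to \<open>A\<close>, need only be isomorphic by an involution \<open>\<tau>\<close>: conjugation of the
second action by \<open>\<tau>\<close> makes them equal on \<open>A\<close>.\<close>

lemma amalgam_actionI_conj:
  assumes "right_action G1 S f1" and "right_action G2 S f2"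
    and \<tau>: "\<And>x. x \<in> S \<Longrightarrow> \<tau> x \<in> S \<and> \<tau> (\<tau> x) = x"
    and eq: "\<And>x a. x \<in> S \<Longrightarrow> a \<in> carrier A \<Longrightarrow> \<tau> (f1 x (\<phi>1 a)) = f2 (\<tau> x) (\<phi>2 a)"
  shows "amalgam_action S f1 (\<lambda>x g. \<tau> (f2 (\<tau> x) g))"
  using assms right_action_conj[OF assms(2) \<tau>]
  by (simp add: amalgam_action_def eq[symmetric] right_actionD(1))

text \<open>Both factors act by right translation of one component of \<open>G\<^sub>1 \<times> G\<^sub>2\<close>. In the coset coordinates \<open>(t\<^sub>1, a)\<close>
and \<open>(t\<^sub>2, b)\<close> of the two components, \<open>A\<close> translates \<open>a\<close> in the first action and \<open>b\<close> in the second, so the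
involution that exchanges \<open>a\<close> and \<open>b\<close> carries one restricted action to the other. Translations have
trivial stabilizers, and conjugation keeps this.\<close>

lemma exists_free_action:
  "\<exists>f1 f2. amalgam_action (carrier G1 \<times> carrier G2) f1 f2 \<and>
    (\<forall>k\<in>carrier G1 \<times> carrier G2. free_at G1 f1 k \<and> free_at G2 f2 k)"
proof -
  let ?K = "carrier G1 \<times> carrier G2"
  obtain t1 d1 where t1: "\<And>g. g \<in> carrier G1 \<Longrightarrow> t1 g \<in> carrier G1"
    and d1: "\<And>g. g \<in> carrier G1 \<Longrightarrow> d1 g \<in> carrier A"
    and td1: "\<And>g. g \<in> carrier G1 \<Longrightarrow> t1 g \<otimes>\<^bsub>G1\<^esub> \<phi>1 (d1 g) = g"
      "\<And>g a. g \<in> carrier G1 \<Longrightarrow> a \<in> carrier A \<Longrightarrow> t1 (t1 g \<otimes>\<^bsub>G1\<^esub> \<phi>1 a) = t1 g"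
      "\<And>g a. g \<in> carrier G1 \<Longrightarrow> a \<in> carrier A \<Longrightarrow> d1 (t1 g \<otimes>\<^bsub>G1\<^esub> \<phi>1 a) = a"
    by (rule mon_transversal[OF G1.is_group A.is_group \<phi>1], rule that)
  obtain t2 d2 where t2: "\<And>g. g \<in> carrier G2 \<Longrightarrow> t2 g \<in> carrier G2"
    and d2: "\<And>g. g \<in> carrier G2 \<Longrightarrow> d2 g \<in> carrier A"
    and td2: "\<And>g. g \<in> carrier G2 \<Longrightarrow> t2 g \<otimes>\<^bsub>G2\<^esub> \<phi>2 (d2 g) = g"
      "\<And>g a. g \<in> carrier G2 \<Longrightarrow> a \<in> carrier A \<Longrightarrow> t2 (t2 g \<otimes>\<^bsub>G2\<^esub> \<phi>2 a) = t2 g"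
      "\<And>g a. g \<in> carrier G2 \<Longrightarrow> a \<in> carrier A \<Longrightarrow> d2 (t2 g \<otimes>\<^bsub>G2\<^esub> \<phi>2 a) = a"
    by (rule mon_transversal[OF G2.is_group A.is_group \<phi>2], rule that)
  define \<sigma> where "\<sigma> = (\<lambda>(g, h). (t1 g \<otimes>\<^bsub>G1\<^esub> \<phi>1 (d2 h), t2 h \<otimes>\<^bsub>G2\<^esub> \<phi>2 (d1 g)))"
  let ?f1 = "\<lambda>k u. (fst k \<otimes>\<^bsub>G1\<^esub> u, snd k)" and ?f2 = "\<lambda>k u. (fst k, snd k \<otimes>\<^bsub>G2\<^esub> u)"
  have act1: "right_action G1 ?K ?f1" and act2: "right_action G2 ?K ?f2"
    by (auto simp: right_action_def G1.m_assoc G2.m_assoc)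
  have \<sigma>: "\<sigma> k \<in> ?K \<and> \<sigma> (\<sigma> k) = k" if "k \<in> ?K" for k
    using that by (auto simp: \<sigma>_def t1 t2 d1 d2 td1 td2)
  have \<sigma>_eq: "\<sigma> (?f1 k (\<phi>1 a)) = ?f2 (\<sigma> k) (\<phi>2 a)" if k: "k \<in> ?K" and a: "a \<in> carrier A" for k a
  proof -
    obtain g h where gh: "k = (g, h)" "g \<in> carrier G1" "h \<in> carrier G2" using k by auto
    have "g \<otimes>\<^bsub>G1\<^esub> \<phi>1 a = t1 g \<otimes>\<^bsub>G1\<^esub> \<phi>1 (d1 g) \<otimes>\<^bsub>G1\<^esub> \<phi>1 a" using td1(1)[OF gh(2)] by simp
    also have "\<dots> = t1 g \<otimes>\<^bsub>G1\<^esub> \<phi>1 (d1 g \<otimes>\<^bsub>A\<^esub> a)" using gh a by (simp add: t1 d1 G1.m_assoc)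
    finally have shift: "g \<otimes>\<^bsub>G1\<^esub> \<phi>1 a = t1 g \<otimes>\<^bsub>G1\<^esub> \<phi>1 (d1 g \<otimes>\<^bsub>A\<^esub> a)" .
    have "t1 (g \<otimes>\<^bsub>G1\<^esub> \<phi>1 a) = t1 g" "d1 (g \<otimes>\<^bsub>G1\<^esub> \<phi>1 a) = d1 g \<otimes>\<^bsub>A\<^esub> a"
      unfolding shift using gh a by (simp_all add: td1(2,3) d1 del: \<phi>1_mult)
    then show ?thesis using gh a by (simp add: \<sigma>_def d1 t2 G2.m_assoc)
  qed
  have act: "amalgam_action ?K ?f1 (\<lambda>k u. \<sigma> (?f2 (\<sigma> k) u))"
  proof (rule amalgam_actionI_conj[where \<tau> = \<sigma> and ?f1.0 = ?f1 and ?f2.0 = ?f2])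
    show "\<sigma> k \<in> ?K \<and> \<sigma> (\<sigma> k) = k" if "k \<in> ?K" for k using that by (rule \<sigma>)
    show "\<sigma> (?f1 k (\<phi>1 a)) = ?f2 (\<sigma> k) (\<phi>2 a)" if "k \<in> ?K" "a \<in> carrier A" for k a
      using that by (rule \<sigma>_eq)
  qed (fact act1, fact act2)
  show ?thesis
  proof (rule exI[of _ ?f1], rule exI[of _ "\<lambda>k u. \<sigma> (?f2 (\<sigma> k) u)"], intro conjI ballI)
    show "amalgam_action ?K ?f1 (\<lambda>k u. \<sigma> (?f2 (\<sigma> k) u))" by (rule act)
    fix k assume k: "k \<in> ?K"
    show "free_at G1 ?f1 k"
      using k by (auto simp: free_at_def)
    show "free_at G2 (\<lambda>k u. \<sigma> (?f2 (\<sigma> k) u)) k"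
      unfolding free_at_def
    proof (intro ballI impI)
      fix u assume u: "u \<in> carrier G2" "\<sigma> (?f2 (\<sigma> k) u) = k"
      have K: "\<sigma> k \<in> ?K" using \<sigma>[OF k] by simp
      then have "?f2 (\<sigma> k) u \<in> ?K" using u(1) by auto
      from \<sigma>[OF this] have "?f2 (\<sigma> k) u = \<sigma> k" unfolding u(2) by simp
      then have "snd (\<sigma> k) \<otimes>\<^bsub>G2\<^esub> u = snd (\<sigma> k)" by (metis snd_conv)
      then show "u = \<one>\<^bsub>G2\<^esub>" using K u(1) by (auto simp: mem_Times_iff)
    qed
  qed
qed

text \<open>A finite piece \<open>F\<close> of an action of the amalgamated product, however large the action, embeds into an
action on a finite set whose size is bounded in terms of the size of \<open>F\<close>. Applied to coset actions,
this is an effective form of the separability of finitely generated subgroups.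

The orbit marks embed \<open>F\<close>, made invariant under \<open>A\<close>, as a set with a partial action of \<open>G\<^sub>1\<close> and as a set
with a partial action of \<open>G\<^sub>2\<close>. Both targets are the same power set \<open>Y\<close>, on which the two groups act
completely and agree on \<open>A\<close>. But the two embeddings differ; so they are put into two disjoint copies of
\<open>Y\<close>, and the action of \<open>G\<^sub>2\<close> is conjugated by the involution that exchanges the two images. After this
the point \<open>x\<close>, placed at its \<open>G\<^sub>1\<close>-mark, moves correctly under both groups. The involution commutes with
\<open>A\<close>, hence the conjugated action of \<open>G\<^sub>2\<close> still agrees with that of \<open>G\<^sub>1\<close> on \<open>A\<close>.\<close>

theorem finite_amalgam_action:
  fixes \<Omega> :: "'s set"
  assumes act: "amalgam_action \<Omega> f1 f2" and F: "F \<subseteq> \<Omega>" "finite F"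
    and fin: "finite (carrier G1)" "finite (carrier G2)" "finite (carrier A)"
  obtains Z :: "(bool \<times> ('s \<times> 'g \<times> 'h) set) set" and b1 b2 j
  where "amalgam_action Z b1 b2" and "finite Z"
    and "card Z \<le> 2 * 2 ^ (card F * (card (carrier A) * (card (carrier G1) * card (carrier G2))))"
    and "inj_on j F" and "j ` F \<subseteq> Z"
    and "\<And>x g. x \<in> F \<Longrightarrow> g \<in> carrier G1 \<Longrightarrow> f1 x g \<in> F \<Longrightarrow> b1 (j x) g = j (f1 x g)"
    and "\<And>x g. x \<in> F \<Longrightarrow> g \<in> carrier G2 \<Longrightarrow> f2 x g \<in> F \<Longrightarrow> b2 (j x) g = j (f2 x g)"
proof -
  have f1: "right_action G1 \<Omega> f1" and f2: "right_action G2 \<Omega> f2"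
    and f12: "\<And>x a. x \<in> \<Omega> \<Longrightarrow> a \<in> carrier A \<Longrightarrow> f1 x (\<phi>1 a) = f2 x (\<phi>2 a)"
    using act by (auto simp: amalgam_action_def)
  let ?K = "carrier G1 \<times> carrier G2"
  obtain k1 k2 where k: "amalgam_action ?K k1 k2"
    and free: "\<And>k. k \<in> ?K \<Longrightarrow> free_at G1 k1 k" "\<And>k. k \<in> ?K \<Longrightarrow> free_at G2 k2 k"
    using exists_free_action by metis
  have k1: "right_action G1 ?K k1" and k2: "right_action G2 ?K k2"
    and k12: "\<And>x a. x \<in> ?K \<Longrightarrow> a \<in> carrier A \<Longrightarrow> k1 x (\<phi>1 a) = k2 x (\<phi>2 a)"
    using k by (auto simp: amalgam_action_def)
  define e where "e = (\<one>\<^bsub>G1\<^esub>, \<one>\<^bsub>G2\<^esub>)"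
  have e: "e \<in> ?K" by (simp add: e_def)
  have hom1: "\<phi>1 \<in> hom A G1" using \<phi>1 by (simp add: mon_def)
  \<comment> \<open>The piece is made invariant under \<open>A\<close>, because only the marks of an \<open>A\<close>-invariant set can be
    exchanged equivariantly.\<close>
  define I where "I = (\<lambda>(x, a). f1 x (\<phi>1 a)) ` (F \<times> carrier A)"
  have I_sub: "I \<subseteq> \<Omega>" using F(1) right_actionD(1)[OF f1] by (auto simp: I_def)
  have F_sub: "F \<subseteq> I"
  proof
    fix x assume x: "x \<in> F"
    then have "x = f1 x (\<phi>1 \<one>\<^bsub>A\<^esub>)" using F(1) right_actionD(2)[OF f1] by auto
    then show "x \<in> I" using x A.one_closed by (force simp: I_def)
  qed
  have I_inv: "f1 x (\<phi>1 a) \<in> I" if x: "x \<in> I" and a: "a \<in> carrier A" for x a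
  proof -
    obtain y b where y: "y \<in> F" "b \<in> carrier A" "x = f1 y (\<phi>1 b)" using x by (auto simp: I_def)
    then have "f1 x (\<phi>1 a) = f1 y (\<phi>1 (b \<otimes>\<^bsub>A\<^esub> a))" using right_actionD(3)[OF f1] F(1) a by auto
    then show ?thesis
      unfolding I_def using y a by (intro image_eqI[of _ _ "(y, b \<otimes>\<^bsub>A\<^esub> a)"]) auto
  qed
  have cI: "right_action A I (\<lambda>x a. f1 x (\<phi>1 a))"
    using right_action_pullback[OF f1 hom1 A.is_group G1.is_group] I_sub I_inv
    by (auto simp: right_action_def)
  have I_card: "finite I" "card I \<le> card F * card (carrier A)"
    using F(2) fin(3) card_image_le[of "F \<times> carrier A" "\<lambda>(x, a). f1 x (\<phi>1 a)"]
    by (auto simp: I_def card_cartesian_product)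
  define Y where "Y = Pow (I \<times> ?K)"
  define Z where "Z = (UNIV :: bool set) \<times> Y"
  define b1 where "b1 z g = (fst z, (\<lambda>(y, k). (y, k1 k g)) ` snd z)" for z :: "bool \<times> ('s \<times> 'g \<times> 'h) set" and g
  define b2 where "b2 z g = (fst z, (\<lambda>(y, k). (y, k2 k g)) ` snd z)" for z :: "bool \<times> ('s \<times> 'g \<times> 'h) set" and g
  have b1: "right_action G1 Z b1" and b2: "right_action G2 Z b2"
    unfolding Z_def Y_def b1_def b2_def
    by (rule right_action_bool, rule right_action_image, rule k1 k2)+
  have b12: "b1 z (\<phi>1 a) = b2 z (\<phi>2 a)" if "z \<in> Z" "a \<in> carrier A" for z a
  proof -
    have "(\<lambda>(y, k). (y, k1 k (\<phi>1 a))) ` snd z = (\<lambda>(y, k). (y, k2 k (\<phi>2 a))) ` snd z"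
      using that k12 by (intro image_cong) (auto simp: Z_def Y_def)
    then show ?thesis by (simp add: b1_def b2_def)
  qed
  define m1 where "m1 x = (True, orbit_mark G1 f1 I k1 e x)" for x
  define m2 where "m2 x = (False, orbit_mark G2 f2 I k2 e x)" for x
  have m_in: "m1 x \<in> Z" "m2 x \<in> Z" for x
    using orbit_mark_in_Pow[OF k1 e] orbit_mark_in_Pow[OF k2 e] by (simp_all add: m1_def m2_def Z_def Y_def)
  have m1_inj: "inj_on m1 I"
    using orbit_mark_inj[OF G1.is_group f1 k1 e free(1)[OF e] I_sub] by (auto simp: m1_def inj_on_def)
  have m2_inj: "inj_on m2 I"
    using orbit_mark_inj[OF G2.is_group f2 k2 e free(2)[OF e] I_sub] by (auto simp: m2_def inj_on_def)
  have m1_eq: "m1 (f1 x g) = b1 (m1 x) g" if "x \<in> I" "g \<in> carrier G1" for x g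
    using orbit_mark_equivariant[OF G1.is_group f1 k1 e I_sub subsetD[OF I_sub that(1)] that(2)]
    by (simp add: m1_def b1_def)
  have m2_eq: "m2 (f2 x g) = b2 (m2 x) g" if "x \<in> I" "g \<in> carrier G2" for x g
    using orbit_mark_equivariant[OF G2.is_group f2 k2 e I_sub subsetD[OF I_sub that(1)] that(2)]
    by (simp add: m2_def b2_def)
  obtain \<tau> where \<tau>: "\<And>z. z \<in> Z \<Longrightarrow> \<tau> z \<in> Z \<and> \<tau> (\<tau> z) = z"
    and \<tau>_eq: "\<And>z a. z \<in> Z \<Longrightarrow> a \<in> carrier A \<Longrightarrow> \<tau> (b1 z (\<phi>1 a)) = b1 (\<tau> z) (\<phi>1 a)"
    and \<tau>_m: "\<And>x. x \<in> I \<Longrightarrow> \<tau> (m1 x) = m2 x" "\<And>x. x \<in> I \<Longrightarrow> \<tau> (m2 x) = m1 x"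
  proof (rule equivariant_swap[OF A.is_group right_action_pullback[OF b1 hom1 A.is_group G1.is_group] cI m1_inj _ _ m2_inj])
    show "m1 ` I \<subseteq> Z" "m2 ` I \<subseteq> Z" using m_in by auto
    show "m1 ` I \<inter> m2 ` I = {}" by (auto simp: m1_def m2_def)
    show "m1 (f1 x (\<phi>1 a)) = b1 (m1 x) (\<phi>1 a)" if "x \<in> I" "a \<in> carrier A" for x a
      using that by (simp add: m1_eq)
    show "m2 (f1 x (\<phi>1 a)) = b1 (m2 x) (\<phi>1 a)" if "x \<in> I" "a \<in> carrier A" for x a
      using that I_sub f12[of x a] m2_eq[of x "\<phi>2 a"] b12[OF m_in(2)] by auto
  qed (rule that)
  show thesis
  proof (rule that)
    show "amalgam_action Z b1 (\<lambda>z g. \<tau> (b2 (\<tau> z) g))"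
    proof (rule amalgam_actionI_conj[where \<tau> = \<tau> and ?f1.0 = b1 and ?f2.0 = b2])
      show "\<tau> (b1 z (\<phi>1 a)) = b2 (\<tau> z) (\<phi>2 a)" if "z \<in> Z" "a \<in> carrier A" for z a
        using \<tau>_eq[OF that] b12[of "\<tau> z" a] \<tau>[OF that(1)] that(2) by simp
    qed (fact b1, fact b2, rule \<tau>)
    show "finite Z" using I_card(1) fin by (simp add: Z_def Y_def)
    have "card Z = 2 * 2 ^ (card I * (card (carrier G1) * card (carrier G2)))"
      using I_card(1) fin by (simp add: Z_def Y_def card_cartesian_product card_Pow)
    also have "\<dots> \<le> 2 * 2 ^ (card F * card (carrier A) * (card (carrier G1) * card (carrier G2)))"
      using I_card(2) by (intro mult_left_mono power_increasing mult_right_mono) auto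
    finally show "card Z \<le> 2 * 2 ^ (card F * (card (carrier A) * (card (carrier G1) * card (carrier G2))))"
      by (simp add: mult.assoc)
    show "inj_on m1 F" using m1_inj F_sub by (rule inj_on_subset)
    show "m1 ` F \<subseteq> Z" using m_in by auto
    show "b1 (m1 x) g = m1 (f1 x g)" if "x \<in> F" "g \<in> carrier G1" for x g
      using that F_sub m1_eq by auto
    \<comment> \<open>The mark is carried to the second copy, moved there by \<open>g\<close>, and carried back.\<close>
    show "\<tau> (b2 (\<tau> (m1 x)) g) = m1 (f2 x g)" if "x \<in> F" "g \<in> carrier G2" "f2 x g \<in> F" for x g
    proof -
      have "x \<in> I" "f2 x g \<in> I" using that F_sub by auto
      then show ?thesis using that(2) by (simp add: \<tau>_m m2_eq[symmetric])
    qed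
  qed
qed

end

section \<open>Actions of presented groups\<close>

text \<open>An action of \<open>gp\<langle>X | R\<rangle>\<close> given by the action of the letters; a word acts by reading it from left to
right. The inverse law is imposed on letters of both signs, so every letter acts as a permutation.\<close>

definition letter_action ::
  "'x set \<Rightarrow> 'x word set \<Rightarrow> 's set \<Rightarrow> ('x letter \<Rightarrow> 's \<Rightarrow> 's) \<Rightarrow> bool"
  where "letter_action X R S a \<longleftrightarrow> (\<forall>l\<in>signed X. \<forall>s\<in>S. a l s \<in> S \<and> a (inv_letter l) (a l s) = s) \<and>
    (\<forall>r\<in>R. \<forall>s\<in>S. fold a r s = s)"

lemma words_Cons [simp]: "l # w \<in> words X \<longleftrightarrow> l \<in> signed X \<and> w \<in> words X"
  by (auto simp: words_def)

lemma words_mono: "X \<subseteq> Y \<Longrightarrow> w \<in> words X \<Longrightarrow> w \<in> words Y"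
  by (auto simp: words_def signed_def in_lists_conv_set)

lemma letter_action_mono:
  assumes "letter_action X R S a" and "X' \<subseteq> X" and "R' \<subseteq> R"
  shows "letter_action X' R' S a"
  using assms by (auto simp: letter_action_def signed_def)

lemma letter_action_closed:
  assumes "letter_action X R S a" and "w \<in> words X" and "s \<in> S"
  shows "fold a w s \<in> S"
  using assms(2,3)
proof (induction w arbitrary: s)
  case (Cons l w)
  then show ?case using assms(1) by (simp add: letter_action_def)
qed simp

lemma letter_action_pres_eq:
  assumes a: "letter_action X R S a" and "pres_eq X R u v" and "s \<in> S"
  shows "fold a u s = fold a v s"
  using assms(2,3)
proof (induction arbitrary: s rule: pres_eq.induct)
  case (cancel u v l)
  then have "fold a u s \<in> S" using letter_action_closed[OF a] by simp
  then show ?case using a cancel.hyps(3) by (simp add: letter_action_def)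
next
  case (relator u v r)
  then have "fold a u s \<in> S" using letter_action_closed[OF a] by simp
  then show ?case using a relator.hyps(3) by (simp add: letter_action_def)
qed simp_all

lemma letter_action_inv_word:
  assumes a: "letter_action X R S a" and w: "w \<in> words X" and s: "s \<in> S"
  shows "fold a (inv_word w) (fold a w s) = s" and "fold a w (fold a (inv_word w) s) = s"
proof -
  have "fold a (w @ inv_word w) s = fold a [] s"
    using pres_eq_right_inverse[OF w] s by (rule letter_action_pres_eq[OF a])
  then show "fold a (inv_word w) (fold a w s) = s" by simp
  have "fold a (inv_word w @ inv_word (inv_word w)) s = fold a [] s"
    using pres_eq_right_inverse[OF inv_word_in_words[OF w]] s by (rule letter_action_pres_eq[OF a])
  then show "fold a w (fold a (inv_word w) s) = s" by simp
qed

text \<open>By this equivalence the relators \<open>u v\<^sup>-\<^sup>1\<close> of the amalgamation express that the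
actions of the two factors agree on \<open>A\<close>.\<close>

lemma letter_action_relator_iff:
  assumes a: "letter_action X R S a" and u: "u \<in> words X" and v: "v \<in> words X"
  shows "(\<forall>s\<in>S. fold a (u @ inv_word v) s = s) \<longleftrightarrow> (\<forall>s\<in>S. fold a u s = fold a v s)"
proof
  assume *: "\<forall>s\<in>S. fold a (u @ inv_word v) s = s"
  show "\<forall>s\<in>S. fold a u s = fold a v s"
  proof
    fix s assume s: "s \<in> S"
    have "fold a v (fold a (inv_word v) (fold a u s)) = fold a u s"
      using a v letter_action_closed[OF a u s] by (rule letter_action_inv_word)
    then show "fold a u s = fold a v s" using * s by simp
  qed
qed (use letter_action_inv_word(1)[OF a v] in simp)

text \<open>Equivalent words act in the same way, hence any representative serves for the action of a class.\<close>

definition class_action :: "('x letter \<Rightarrow> 's \<Rightarrow> 's) \<Rightarrow> 's \<Rightarrow> 'x word set \<Rightarrow> 's"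
  where "class_action a s c = fold a (SOME w. w \<in> c) s"

lemma class_action_word_class:
  assumes a: "letter_action X R S a" and w: "w \<in> words X" and s: "s \<in> S"
  shows "class_action a s (word_class X R w) = fold a w s"
proof -
  have "w \<in> word_class X R w" using w by (simp add: word_class_def pres_rel_def pres_eq.refl)
  then have "(SOME v. v \<in> word_class X R w) \<in> word_class X R w" by (rule someI)
  then have "pres_eq X R w (SOME v. v \<in> word_class X R w)"
    by (simp add: word_class_def pres_rel_def)
  from letter_action_pres_eq[OF a this s] show ?thesis by (simp add: class_action_def)
qed

lemma right_action_class_action:
  assumes R: "R \<subseteq> words X" and a: "letter_action X R S a"
  shows "right_action (gp X R) S (class_action a)"
  unfolding right_action_def
proof (intro conjI ballI)
  fix s c assume "s \<in> S" "c \<in> carrier (gp X R)"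
  then show "class_action a s c \<in> S"
    using letter_action_closed[OF a] by (auto simp: carrier_gp class_action_word_class[OF a])
next
  fix s assume "s \<in> S"
  then show "class_action a s \<one>\<^bsub>gp X R\<^esub> = s" by (simp add: one_gp class_action_word_class[OF a])
next
  fix s c d assume s: "s \<in> S" and "c \<in> carrier (gp X R)" "d \<in> carrier (gp X R)"
  then obtain u v where uv: "u \<in> words X" "c = word_class X R u" "v \<in> words X" "d = word_class X R v"
    by (auto simp: carrier_gp)
  then show "class_action a s (c \<otimes>\<^bsub>gp X R\<^esub> d) = class_action a (class_action a s c) d"
    using s letter_action_closed[OF a uv(1) s]
    by (simp add: word_class_mult[OF R] class_action_word_class[OF a])
qed

lemma fold_right_action:
  assumes R: "R \<subseteq> words X" and b: "right_action (gp X R) S b"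
    and a: "\<And>l s. l \<in> signed X \<Longrightarrow> s \<in> S \<Longrightarrow> a l s = b s (word_class X R [l])"
    and "w \<in> words X" and "s \<in> S"
  shows "fold a w s = b s (word_class X R w)"
  using assms(4,5)
proof (induction w arbitrary: s)
  case Nil
  then show ?case using right_actionD(2)[OF b] by (simp add: one_gp)
next
  case (Cons l w)
  then have l: "[l] \<in> words X" and w: "w \<in> words X" by simp_all
  have c: "word_class X R [l] \<in> carrier (gp X R)" "word_class X R w \<in> carrier (gp X R)"
    using l w by (auto simp: carrier_gp)
  have "word_class X R (l # w) = word_class X R [l] \<otimes>\<^bsub>gp X R\<^esub> word_class X R w"
    using l w by (simp add: word_class_mult[OF R])
  then show ?case
    using Cons a right_actionD(1)[OF b Cons.prems(2) c(1)] right_actionD(3)[OF b Cons.prems(2) c]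
    by simp
qed


text \<open>The stabilizer of a point is a subgroup. Thus an action in which the \<open>h\<^sub>i\<close> fix a point that \<open>g\<close> moves
certifies that \<open>g\<close> is not in the subgroup generated by the \<open>h\<^sub>i\<close>.\<close>

lemma letter_action_generate:
  assumes R: "R \<subseteq> words X" and a: "letter_action X R S a" and s: "s \<in> S"
    and W: "W \<subseteq> words X" "\<And>h. h \<in> W \<Longrightarrow> fold a h s = s"
    and w: "w \<in> words X" "word_class X R w \<in> generate (gp X R) (word_class X R ` W)"
  shows "fold a w s = s"
proof -
  interpret group "gp X R" by (rule group_gp[OF R])
  note act = right_action_class_action[OF R a]
  have "c \<in> carrier (gp X R) \<and> class_action a s c = s"
    if "c \<in> generate (gp X R) (word_class X R ` W)" for c
    using that
  proof (induction rule: generate.induct)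
    case one
    then show ?case using right_actionD(2)[OF act s] by simp
  next
    case (incl h)
    then show ?case using W s by (auto simp: carrier_gp class_action_word_class[OF a])
  next
    case (inv h)
    then have h: "h \<in> carrier (gp X R)" and "class_action a s h = s"
      using W s by (auto simp: carrier_gp class_action_word_class[OF a])
    then show ?case using right_action_inv(1)[OF is_group act s h] by simp
  next
    case (eng h1 h2)
    then show ?case using right_actionD(3)[OF act s] by simp
  qed
  from this[OF w(2)] show ?thesis using class_action_word_class[OF a w(1) s] by simp
qed

definition coset_shift :: "'x set \<Rightarrow> 'x word set \<Rightarrow> 'x letter \<Rightarrow> 'x word set set \<Rightarrow> 'x word set set"
  where "coset_shift X R l c = c #>\<^bsub>gp X R\<^esub> word_class X R [l]"

lemma fold_coset_shift:
  assumes R: "R \<subseteq> words X" and H: "H \<subseteq> carrier (gp X R)"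
    and w: "w \<in> words X" and x: "x \<in> carrier (gp X R)"
  shows "fold (coset_shift X R) w (H #>\<^bsub>gp X R\<^esub> x) = H #>\<^bsub>gp X R\<^esub> (x \<otimes>\<^bsub>gp X R\<^esub> word_class X R w)"
  using w x
proof (induction w arbitrary: x)
  interpret group "gp X R" by (rule group_gp[OF R])
  {
    case Nil
    then show ?case by (simp add: one_gp[symmetric])
  next
    case (Cons l w)
    then have l: "[l] \<in> words X" and w: "w \<in> words X" by simp_all
    then have c: "word_class X R [l] \<in> carrier (gp X R)" "word_class X R w \<in> carrier (gp X R)"
      by (simp_all only: carrier_gp imageI)
    have "word_class X R (l # w) = word_class X R [l] \<otimes>\<^bsub>gp X R\<^esub> word_class X R w"
      using l w by (simp add: word_class_mult[OF R])
    then show ?case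
      using Cons.IH[OF w m_closed[OF Cons.prems(2) c(1)]] Cons.prems(2) c
      by (simp add: coset_shift_def coset_mult_assoc[OF H] m_assoc)
  }
qed

text \<open>The action on the right cosets of \<open>H\<close> separates from \<open>H\<close> every element outside it; it may be infinite.\<close>

lemma letter_action_coset_shift:
  assumes R: "R \<subseteq> words X" and H: "subgroup H (gp X R)"
  shows "letter_action X R (rcosets\<^bsub>gp X R\<^esub> H) (coset_shift X R)"
    and "H \<in> rcosets\<^bsub>gp X R\<^esub> H"
    and "w \<in> words X \<Longrightarrow> fold (coset_shift X R) w H = H \<longleftrightarrow> word_class X R w \<in> H"
proof -
  interpret group "gp X R" by (rule group_gp[OF R])
  have H_sub: "H \<subseteq> carrier (gp X R)" using H by (rule subgroup.subset)
  have H_one: "H #>\<^bsub>gp X R\<^esub> \<one>\<^bsub>gp X R\<^esub> = H" using H_sub by simp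
  note fold = fold_coset_shift[OF R H_sub]
  have c: "word_class X R v \<in> carrier (gp X R)" if "v \<in> words X" for v
    using that by (auto simp: carrier_gp)
  have triv: "fold (coset_shift X R) v (H #>\<^bsub>gp X R\<^esub> x) = H #>\<^bsub>gp X R\<^esub> x"
    if "pres_eq X R v []" "x \<in> carrier (gp X R)" for v x
  proof -
    have v: "v \<in> words X" using pres_eq_words[OF that(1) R] by simp
    then have "word_class X R v = \<one>\<^bsub>gp X R\<^esub>" using that(1) by (simp add: one_gp word_class_eq_iff[OF R])
    then show ?thesis using fold[OF v that(2)] that(2) by simp
  qed
  show "letter_action X R (rcosets\<^bsub>gp X R\<^esub> H) (coset_shift X R)"
    unfolding letter_action_def
  proof (intro conjI ballI)
    fix l s assume l: "l \<in> signed X" and "s \<in> rcosets\<^bsub>gp X R\<^esub> H"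
    then obtain x where x: "x \<in> carrier (gp X R)" "s = H #>\<^bsub>gp X R\<^esub> x" by (auto simp: RCOSETS_def)
    show "coset_shift X R l s \<in> rcosets\<^bsub>gp X R\<^esub> H"
      using fold[of "[l]" x] x l c[of "[l]"] by (simp add: rcosetsI[OF H_sub])
    show "coset_shift X R (inv_letter l) (coset_shift X R l s) = s"
      using triv[of "[l, inv_letter l]" x] x pres_eq.cancel[of "[]" X "[]" l R] l by simp
  next
    fix r s assume r: "r \<in> R" and "s \<in> rcosets\<^bsub>gp X R\<^esub> H"
    then obtain x where x: "x \<in> carrier (gp X R)" "s = H #>\<^bsub>gp X R\<^esub> x" by (auto simp: RCOSETS_def)
    then show "fold (coset_shift X R) r s = s"
      using triv[of r x] pres_eq.relator[of "[]" X "[]" r R] r by simp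
  qed
  show "H \<in> rcosets\<^bsub>gp X R\<^esub> H" using rcosetsI[OF H_sub one_closed] H_one by simp
  show "fold (coset_shift X R) w H = H \<longleftrightarrow> word_class X R w \<in> H" if w: "w \<in> words X"
  proof -
    have "fold (coset_shift X R) w H = H #>\<^bsub>gp X R\<^esub> word_class X R w"
      using fold[OF w one_closed] H_one c[OF w] by simp
    then show ?thesis using coset_join1[OF _ c[OF w] H] coset_join2[OF c[OF w] H] by auto
  qed
qed

text \<open>Bounds the number of points of the separating action: twice the size of the power set of a set of
\<open>(n + 1)\<^sup>2 k\<close> elements, where \<open>k\<close> depends on the amalgam and \<open>n\<close> on the input.\<close>

definition degree_bound :: "nat \<Rightarrow> nat \<Rightarrow> nat"
  where "degree_bound k n = 2 * 2 ^ (Suc n * Suc n * k)"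

locale presented_amalgam =
  fixes X1 X2 :: "'x set" and R1 R2 :: "'x word set" and A :: "('a, 'm) monoid_scheme"
    and \<phi>1 \<phi>2 :: "'a \<Rightarrow> 'x word set"
  assumes R1: "R1 \<subseteq> words X1" and R2: "R2 \<subseteq> words X2"
    and fin1: "finite (carrier (gp X1 R1))" and fin2: "finite (carrier (gp X2 R2))"
    and disjoint: "signed X1 \<inter> signed X2 = {}"
    and A: "group A" "finite (carrier A)"
    and \<phi>1: "\<phi>1 \<in> mon A (gp X1 R1)" and \<phi>2: "\<phi>2 \<in> mon A (gp X2 R2)"
begin

abbreviation X where "X \<equiv> X1 \<union> X2"
abbreviation R where "R \<equiv> amalgam_relators R1 R2 A \<phi>1 \<phi>2"

sublocale amalgam "gp X1 R1" "gp X2 R2" A \<phi>1 \<phi>2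
  using group_gp[OF R1] group_gp[OF R2] A(1) \<phi>1 \<phi>2
  by (simp add: amalgam_def amalgam_axioms_def)

lemma word_class_\<phi>:
  "a \<in> carrier A \<Longrightarrow> u \<in> \<phi>1 a \<Longrightarrow> u \<in> words X1 \<and> \<phi>1 a = word_class X1 R1 u"
  "a \<in> carrier A \<Longrightarrow> u \<in> \<phi>2 a \<Longrightarrow> u \<in> words X2 \<and> \<phi>2 a = word_class X2 R2 u"
proof -
  have *: "u \<in> words Y \<and> c = word_class Y Q u"
    if c: "c \<in> carrier (gp Y Q)" and u: "u \<in> c" and Q: "Q \<subseteq> words Y" for u c Y and Q :: "'x word set"
  proof -
    obtain w where w: "w \<in> words Y" "c = word_class Y Q w" using c by (auto simp: carrier_gp)
    then have "pres_eq Y Q w u" using u by (simp add: word_class_def pres_rel_def)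
    then show ?thesis using w pres_eq_words[OF _ Q] word_class_eq_iff[OF Q] by metis
  qed
  show "a \<in> carrier A \<Longrightarrow> u \<in> \<phi>1 a \<Longrightarrow> u \<in> words X1 \<and> \<phi>1 a = word_class X1 R1 u"
    using *[OF \<phi>1_closed _ R1] by blast
  show "a \<in> carrier A \<Longrightarrow> u \<in> \<phi>2 a \<Longrightarrow> u \<in> words X2 \<and> \<phi>2 a = word_class X2 R2 u"
    using *[OF \<phi>2_closed _ R2] by blast
qed

lemma words_12: "w \<in> words X1 \<Longrightarrow> w \<in> words X" "w \<in> words X2 \<Longrightarrow> w \<in> words X"
  by (auto intro: words_mono)

lemma R_sub: "R \<subseteq> words X"
  using R1 R2 word_class_\<phi> words_12
  by (auto simp: amalgam_relators_def intro!: inv_word_in_words)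

lemma class_nonempty: "c \<in> carrier (gp Y Q) \<Longrightarrow> \<exists>u. u \<in> c"
  by (auto simp: carrier_gp word_class_def pres_rel_def intro: pres_eq.refl)

lemma amalgam_action_class_action:
  assumes a: "letter_action X R S a"
  shows "amalgam_action S (class_action a) (class_action a)"
  unfolding amalgam_action_def
proof (intro conjI ballI)
  have a1: "letter_action X1 R1 S a" and a2: "letter_action X2 R2 S a"
    by (rule letter_action_mono[OF a]; auto simp: amalgam_relators_def)+
  then show "right_action (gp X1 R1) S (class_action a)" "right_action (gp X2 R2) S (class_action a)"
    using R1 R2 by (auto intro: right_action_class_action)
  fix s c assume s: "s \<in> S" and c: "c \<in> carrier A"
  obtain u v where uv: "u \<in> \<phi>1 c" "v \<in> \<phi>2 c"
    using class_nonempty[OF \<phi>1_closed[OF c]] class_nonempty[OF \<phi>2_closed[OF c]] by blast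
  then have "u @ inv_word v \<in> R" using c by (auto simp: amalgam_relators_def)
  then have "\<forall>s\<in>S. fold a (u @ inv_word v) s = s" using a unfolding letter_action_def by blast
  then have "fold a u s = fold a v s"
    using letter_action_relator_iff[OF a] uv c s word_class_\<phi> words_12 by metis
  then show "class_action a s (\<phi>1 c) = class_action a s (\<phi>2 c)"
    using word_class_\<phi>[OF c] uv s class_action_word_class[OF a1] class_action_word_class[OF a2] by metis
qed

text \<open>Every letter belongs to exactly one of the two generating sets, and acts through the action of the
corresponding factor.\<close>

definition glue :: "('s \<Rightarrow> 'x word set \<Rightarrow> 's) \<Rightarrow> ('s \<Rightarrow> 'x word set \<Rightarrow> 's) \<Rightarrow> 'x letter \<Rightarrow> 's \<Rightarrow> 's"
  where "glue b1 b2 l s = (if l \<in> signed X1 then b1 s (word_class X1 R1 [l]) else b2 s (word_class X2 R2 [l]))"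

text \<open>Words in the letters of one factor act through their class in that factor. So the relators of the
factors act trivially because their classes are trivial, and the relators of the amalgamation because
the two actions agree on \<open>A\<close>.\<close>

lemma letter_action_glue:
  assumes "amalgam_action S b1 b2"
  shows "letter_action X R S (glue b1 b2)"
proof -
  let ?b = "glue b1 b2"
  have b1: "right_action (gp X1 R1) S b1" and b2: "right_action (gp X2 R2) S b2"
    and b12: "\<And>s c. s \<in> S \<Longrightarrow> c \<in> carrier A \<Longrightarrow> b1 s (\<phi>1 c) = b2 s (\<phi>2 c)"
    using assms by (auto simp: amalgam_action_def)
  have f1: "fold ?b w s = b1 s (word_class X1 R1 w)" if "w \<in> words X1" "s \<in> S" for w s
    using R1 b1 _ that by (rule fold_right_action) (simp add: glue_def)
  have f2: "fold ?b w s = b2 s (word_class X2 R2 w)" if "w \<in> words X2" "s \<in> S" for w s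
    using R2 b2 _ that by (rule fold_right_action) (use disjoint in \<open>auto simp: glue_def\<close>)
  have cl: "word_class Y Q w \<in> carrier (gp Y Q)" if "w \<in> words Y" for Y Q and w :: "'x word"
    using that by (auto simp: carrier_gp)
  have empty: "letter_action X {} S ?b"
    unfolding letter_action_def
  proof (intro conjI ballI)
    fix l s assume l: "l \<in> signed X" and s: "s \<in> S"
    consider "[l] \<in> words X1" | "[l] \<in> words X2" using l by (auto simp: signed_def)
    then show "?b l s \<in> S"
    proof cases
      case 1
      then show ?thesis using f1[OF 1 s] right_actionD(1)[OF b1 s cl[OF 1]] by simp
    next
      case 2
      then show ?thesis using f2[OF 2 s] right_actionD(1)[OF b2 s cl[OF 2]] by simp
    qed
    have w: "fold ?b (w @ inv_word w) s = s" if "w \<in> words X1 \<or> w \<in> words X2" for w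
      using that
    proof
      assume w: "w \<in> words X1"
      then have "word_class X1 R1 (w @ inv_word w) = \<one>\<^bsub>gp X1 R1\<^esub>"
        using pres_eq_right_inverse[OF w] inv_word_in_words[OF w] by (simp add: one_gp word_class_eq_iff[OF R1])
      then show ?thesis
        using f1[of "w @ inv_word w" s] w inv_word_in_words[OF w] s right_actionD(2)[OF b1 s] by simp
    next
      assume w: "w \<in> words X2"
      then have "word_class X2 R2 (w @ inv_word w) = \<one>\<^bsub>gp X2 R2\<^esub>"
        using pres_eq_right_inverse[OF w] inv_word_in_words[OF w] by (simp add: one_gp word_class_eq_iff[OF R2])
      then show ?thesis
        using f2[of "w @ inv_word w" s] w inv_word_in_words[OF w] s right_actionD(2)[OF b2 s] by simp
    qed
    show "?b (inv_letter l) (?b l s) = s"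
      using w[of "[l]"] l by (auto simp: signed_def inv_word_def)
  qed simp
  have "fold ?b r s = s" if r: "r \<in> R" and s: "s \<in> S" for r s
  proof -
    consider "r \<in> R1" | "r \<in> R2" | c u v where "c \<in> carrier A" "u \<in> \<phi>1 c" "v \<in> \<phi>2 c" "r = u @ inv_word v"
      using r by (auto simp: amalgam_relators_def)
    then show ?thesis
    proof cases
      case 1
      then have w: "r \<in> words X1" and "pres_eq X1 R1 r []"
        using R1 pres_eq.relator[of "[]" X1 "[]" r R1] by auto
      then have "word_class X1 R1 r = \<one>\<^bsub>gp X1 R1\<^esub>" by (simp add: one_gp word_class_eq_iff[OF R1])
      then show ?thesis using f1[OF w s] right_actionD(2)[OF b1 s] by simp
    next
      case 2
      then have w: "r \<in> words X2" and "pres_eq X2 R2 r []"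
        using R2 pres_eq.relator[of "[]" X2 "[]" r R2] by auto
      then have "word_class X2 R2 r = \<one>\<^bsub>gp X2 R2\<^esub>" by (simp add: one_gp word_class_eq_iff[OF R2])
      then show ?thesis using f2[OF w s] right_actionD(2)[OF b2 s] by simp
    next
      case 3
      have u: "u \<in> words X1" "\<phi>1 c = word_class X1 R1 u" using word_class_\<phi>(1)[OF 3(1,2)] by auto
      have v: "v \<in> words X2" "\<phi>2 c = word_class X2 R2 v" using word_class_\<phi>(2)[OF 3(1,3)] by auto
      have "\<forall>s\<in>S. fold ?b u s = fold ?b v s" using f1[OF u(1)] f2[OF v(1)] b12[OF _ 3(1)] u(2) v(2) by simp
      then show ?thesis
        using letter_action_relator_iff[OF empty words_12(1)[OF u(1)] words_12(2)[OF v(1)]] 3(4) s by simp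
    qed
  qed
  then show ?thesis using empty by (simp add: letter_action_def)
qed

text \<open>The set of all relators is in general infinite, because the relation \<open>\<phi>\<^sub>1 c = \<phi>\<^sub>2 c\<close> is imposed for all
representatives. A program can check one choice of representatives for each \<open>c\<close>; the next lemmas show
that it accepts the same actions.\<close>

definition finite_relators :: "'x word set"
  where "finite_relators = R1 \<union> R2 \<union>
    (\<lambda>c. (SOME u. u \<in> \<phi>1 c) @ inv_word (SOME v. v \<in> \<phi>2 c)) ` carrier A"

lemma some_in_\<phi>:
  assumes "c \<in> carrier A"
  shows "(SOME u. u \<in> \<phi>1 c) \<in> \<phi>1 c" and "(SOME v. v \<in> \<phi>2 c) \<in> \<phi>2 c"
  using class_nonempty[OF \<phi>1_closed[OF assms]] class_nonempty[OF \<phi>2_closed[OF assms]]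
  by (auto intro: someI_ex)

lemma finite_relators_sub: "finite_relators \<subseteq> R"
  using some_in_\<phi> by (fastforce simp: finite_relators_def amalgam_relators_def)

text \<open>Once \<open>R\<^sub>1\<close> and \<open>R\<^sub>2\<close> act trivially, all representatives of \<open>\<phi>\<^sub>1 c\<close> act alike, and so do those of \<open>\<phi>\<^sub>2 c\<close>;
one relation between chosen representatives then implies all others.\<close>

lemma letter_action_finite_relators:
  assumes a: "letter_action X finite_relators S a"
  shows "letter_action X R S a"
proof -
  have a1: "letter_action X1 R1 S a" and a2: "letter_action X2 R2 S a" and a0: "letter_action X {} S a"
    by (rule letter_action_mono[OF a]; auto simp: finite_relators_def)+
  have "fold a r s = s" if r: "r \<in> R" and s: "s \<in> S" for r s
  proof -
    consider "r \<in> R1 \<union> R2" | c u v where "c \<in> carrier A" "u \<in> \<phi>1 c" "v \<in> \<phi>2 c" "r = u @ inv_word v"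
      using r by (auto simp: amalgam_relators_def)
    then show ?thesis
    proof cases
      case 1
      then show ?thesis using a s by (auto simp: letter_action_def finite_relators_def)
    next
      case (2 c u v)
      let ?u = "SOME u. u \<in> \<phi>1 c" and ?v = "SOME v. v \<in> \<phi>2 c"
      note u = word_class_\<phi>(1)[OF 2(1,2)] word_class_\<phi>(1)[OF 2(1) some_in_\<phi>(1)[OF 2(1)]]
      note v = word_class_\<phi>(2)[OF 2(1,3)] word_class_\<phi>(2)[OF 2(1) some_in_\<phi>(2)[OF 2(1)]]
      have "?u @ inv_word ?v \<in> finite_relators" using 2(1) by (auto simp: finite_relators_def)
      then have "\<forall>s\<in>S. fold a (?u @ inv_word ?v) s = s" using a unfolding letter_action_def by blast
      then have "\<forall>s\<in>S. fold a ?u s = fold a ?v s"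
        using letter_action_relator_iff[OF a0] u v words_12 by blast
      moreover have "fold a u s = fold a ?u s" "fold a v s = fold a ?v s" if "s \<in> S" for s
        using u v class_action_word_class[OF a1 _ that] class_action_word_class[OF a2 _ that] by metis+
      ultimately have "\<forall>s\<in>S. fold a u s = fold a v s" by simp
      then show ?thesis
        using letter_action_relator_iff[OF a0] u v words_12 2(4) s by blast
    qed
  qed
  then show ?thesis using a by (auto simp: letter_action_def)
qed

definition amalgam_size :: nat
  where "amalgam_size = card (carrier A) * (card (carrier (gp X1 R1)) * card (carrier (gp X2 R2)))"

text \<open>Words of length at most \<open>n\<close> and at most \<open>n\<close> generators visit at most \<open>(n + 1)\<^sup>2\<close> cosets when they are
read from the coset \<open>H\<close>. These cosets form the finite piece \<open>F\<close> of the coset action. In the finite action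
into which \<open>F\<close> embeds, the words follow the same paths, so the \<open>h\<^sub>i\<close> still return to the point of \<open>H\<close> and \<open>g\<close>
does not.\<close>

theorem separating_letter_action:
  assumes g: "g \<in> words X" and hs: "set hs \<subseteq> words X"
    and notin: "word_class X R g \<notin> generate (gp X R) (word_class X R ` set hs)"
    and len: "length hs \<le> n" "\<And>w. w \<in> set (g # hs) \<Longrightarrow> length w \<le> n"
  obtains Z :: "(bool \<times> ('x word set set \<times> 'x word set \<times> 'x word set) set) set" and b z
  where "letter_action X R Z b" and "finite Z" and "card Z \<le> degree_bound amalgam_size n"
    and "z \<in> Z" and "\<And>h. h \<in> set hs \<Longrightarrow> fold b h z = z" and "fold b g z \<noteq> z"
proof -
  let ?G = "gp X R"
  interpret G: group ?G by (rule group_gp[OF R_sub])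
  define H where "H = generate ?G (word_class X R ` set hs)"
  have H: "subgroup H ?G"
    unfolding H_def by (rule G.generate_is_subgroup) (use hs in \<open>auto simp: carrier_gp\<close>)
  let ?\<Omega> = "rcosets\<^bsub>?G\<^esub> H" and ?a = "coset_shift X R"
  note a = letter_action_coset_shift[OF R_sub H]
  have a1: "letter_action X1 R1 ?\<Omega> ?a" and a2: "letter_action X2 R2 ?\<Omega> ?a"
    by (rule letter_action_mono[OF a(1)]; auto simp: amalgam_relators_def)+
  have ws: "w \<in> words X" if "w \<in> set (g # hs)" for w using that g hs by auto
  define F where "F = (\<lambda>(i, k). fold ?a (take k ((g # hs) ! i)) H) ` ({..<Suc (length hs)} \<times> {..n})"
  have F_prefix: "fold ?a (take k w) H \<in> F" if w: "w \<in> set (g # hs)" and k: "k \<le> length w" for w k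
  proof -
    obtain i where i: "i < length (g # hs)" "w = (g # hs) ! i" using w by (metis in_set_conv_nth)
    moreover have "k \<le> n" using k len(2)[OF w] by simp
    ultimately show ?thesis unfolding F_def by (intro image_eqI[of _ _ "(i, k)"]) auto
  qed
  have prefix_words: "take k w \<in> words X" if "w \<in> words X" for w :: "'x word" and k
    using that by (metis append_take_drop_id words_append)
  have F_sub: "F \<subseteq> ?\<Omega>"
  proof
    fix c assume "c \<in> F"
    then obtain i k where ik: "i < Suc (length hs)" "c = fold ?a (take k ((g # hs) ! i)) H"
      by (auto simp: F_def)
    then have "(g # hs) ! i \<in> set (g # hs)" by (intro nth_mem) simp
    then show "c \<in> ?\<Omega>"
      unfolding ik(2) using letter_action_closed[OF a(1) prefix_words[OF ws] a(2)] by blast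
  qed
  have F_fin: "finite F" by (simp add: F_def)
  have "card F \<le> card ({..<Suc (length hs)} \<times> {..n})" unfolding F_def by (rule card_image_le) simp
  also have "\<dots> \<le> Suc n * Suc n" using len(1) by (simp add: card_cartesian_product del: mult_Suc mult_Suc_right)
  finally have F_card: "card F \<le> Suc n * Suc n" .
  obtain Z :: "(bool \<times> ('x word set set \<times> 'x word set \<times> 'x word set) set) set" and b1 b2 j
    where Z: "amalgam_action Z b1 b2" "finite Z" "card Z \<le> 2 * 2 ^ (card F * amalgam_size)"
      and j: "inj_on j F" "j ` F \<subseteq> Z"
      and j1: "\<And>x c. x \<in> F \<Longrightarrow> c \<in> carrier (gp X1 R1) \<Longrightarrow> class_action ?a x c \<in> F \<Longrightarrow> b1 (j x) c = j (class_action ?a x c)"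
      and j2: "\<And>x c. x \<in> F \<Longrightarrow> c \<in> carrier (gp X2 R2) \<Longrightarrow> class_action ?a x c \<in> F \<Longrightarrow> b2 (j x) c = j (class_action ?a x c)"
    by (rule finite_amalgam_action[OF amalgam_action_class_action[OF a(1)] F_sub F_fin fin1 fin2 A(2),
      folded amalgam_size_def], rule that)
  let ?b = "glue b1 b2"
  have j_letter: "?b l (j x) = j (?a l x)" if l: "l \<in> signed X" and x: "x \<in> F" and lx: "?a l x \<in> F" for l x
  proof -
    have x': "x \<in> ?\<Omega>" using x F_sub by blast
    show ?thesis
    proof (cases "l \<in> signed X1")
      case True
      then have "[l] \<in> words X1" by simp
      then have "class_action ?a x (word_class X1 R1 [l]) = ?a l x" "word_class X1 R1 [l] \<in> carrier (gp X1 R1)"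
        using class_action_word_class[OF a1 _ x', of "[l]"] by (simp_all add: carrier_gp)
      then show ?thesis using True j1[OF x] lx by (simp add: glue_def)
    next
      case False
      then have "[l] \<in> words X2" using l by (auto simp: signed_def)
      then have "class_action ?a x (word_class X2 R2 [l]) = ?a l x" "word_class X2 R2 [l] \<in> carrier (gp X2 R2)"
        using class_action_word_class[OF a2 _ x', of "[l]"] by (simp_all add: carrier_gp)
      then show ?thesis using False j2[OF x] lx by (simp add: glue_def)
    qed
  qed
  have "fold ?b (take k w) (j H) = j (fold ?a (take k w) H)"
    if w: "w \<in> set (g # hs)" and "k \<le> length w" for w k
    using that(2)
  proof (induction k)
    case (Suc k)
    then have k: "k < length w" by simp
    have "w ! k \<in> signed X" using ws[OF w] nth_mem[OF k] by (auto simp: words_def)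
    moreover have "fold ?a (take k w) H \<in> F" "?a (w ! k) (fold ?a (take k w) H) \<in> F"
      using F_prefix[OF w, of k] F_prefix[OF w, of "Suc k"] k by (simp_all add: take_Suc_conv_app_nth)
    ultimately show ?case
      using Suc j_letter by (simp add: take_Suc_conv_app_nth[OF k])
  qed simp
  from this[OF _ order_refl] have j_word: "fold ?b w (j H) = j (fold ?a w H)" if "w \<in> set (g # hs)" for w
    using that by simp
  have H_F: "H \<in> F" using F_prefix[of g 0] by simp
  show thesis
  proof (rule that)
    show "letter_action X R Z ?b" by (rule letter_action_glue[OF Z(1)])
    show "finite Z" by (rule Z(2))
    show "card Z \<le> degree_bound amalgam_size n"
      unfolding degree_bound_def
      by (rule order_trans[OF Z(3)]) (intro mult_left_mono power_increasing mult_right_mono F_card; simp)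
    show "j H \<in> Z" using H_F j(2) by blast
    show "fold ?b h (j H) = j H" if h: "h \<in> set hs" for h
    proof -
      have "word_class X R h \<in> H" using h by (auto simp: H_def intro: generate.incl)
      then have "fold ?a h H = H" using a(3)[OF ws[of h]] h by simp
      then show ?thesis using j_word[of h] h by simp
    qed
    have "fold ?a g H \<noteq> H" using a(3)[OF g] notin by (simp add: H_def)
    moreover have "fold ?a g H \<in> F" using F_prefix[of g "length g"] by simp
    ultimately show "fold ?b g (j H) \<noteq> j H" using j_word[of g] j(1) H_F by (auto dest: inj_onD)
  qed
qed

end

section \<open>Tables of finite actions\<close>

text \<open>A number \<open>t\<close> encodes a table of an action of letter codes on \<open>{0, \<dots>, m - 1}\<close> by its digits in base \<open>m\<close>:
the digit at position \<open>l m + s\<close> is the image of \<open>s\<close> under \<open>l\<close>. Every \<open>t\<close> is a table of maps into that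
range, and all tables for letter codes below \<open>L\<close> occur among the \<open>t < m ^ (L * m)\<close>, so a search for an
action is a bounded search for a number.\<close>

definition table_action :: "nat \<Rightarrow> nat \<Rightarrow> nat \<Rightarrow> nat \<Rightarrow> nat"
  where "table_action m t l s = t div m ^ (l * m + s) mod m"

lemma exists_digits:
  fixes m :: nat
  assumes "\<And>j. j < N \<Longrightarrow> f j < m"
  shows "\<exists>t<m ^ N. \<forall>j<N. t div m ^ j mod m = f j"
  using assms
proof (induction N arbitrary: f)
  case (Suc N)
  have "\<exists>t<m ^ N. \<forall>j<N. t div m ^ j mod m = f (Suc j)"
    by (rule Suc.IH) (simp add: Suc.prems)
  then obtain t where t: "t < m ^ N" "\<And>j. j < N \<Longrightarrow> t div m ^ j mod m = f (Suc j)"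
    by auto
  have f0: "f 0 < m" using Suc.prems by simp
  have "(f 0 + m * t) div m ^ j mod m = f j" if "j < Suc N" for j
  proof (cases j)
    case (Suc i)
    have "(f 0 + m * t) div m ^ Suc i = t div m ^ i" using f0 by (simp add: div_mult2_eq)
    then show ?thesis using Suc that t(2) by simp
  qed (use f0 in simp)
  moreover have "f 0 + m * t < m ^ Suc N"
  proof -
    have "f 0 + m * t < m * Suc t" using f0 by simp
    also have "\<dots> \<le> m * m ^ N" using t(1) by (intro mult_le_mono2) simp
    finally show ?thesis by simp
  qed
  ultimately show ?case by blast
qed simp

lemma exists_table_action:
  assumes c: "inj_on c D" "\<And>l. l \<in> D \<Longrightarrow> c l < L" and S: "finite S"
    and a: "\<And>l s. l \<in> D \<Longrightarrow> s \<in> S \<Longrightarrow> a l s \<in> S"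
  obtains e t where "bij_betw e S {..<card S}" and "t < card S ^ (L * card S)"
    and "\<And>l s. l \<in> D \<Longrightarrow> s \<in> S \<Longrightarrow> table_action (card S) t (c l) (e s) = e (a l s)"
proof -
  let ?m = "card S"
  obtain e where e: "bij_betw e S {..<?m}"
    using ex_bij_betw_finite_nat[OF S] by (auto simp: atLeast0LessThan)
  have e_less: "e s < ?m" if "s \<in> S" for s using e that by (auto simp: bij_betw_def)
  \<comment> \<open>Outside the coded letters any value in range would do; \<open>j mod m\<close> keeps all digits below \<open>m\<close>.\<close>
  define f where "f j = (if j div ?m \<in> c ` D \<and> j mod ?m < ?m
    then e (a (inv_into D c (j div ?m)) (inv_into S e (j mod ?m))) else j mod ?m)" for j
  have inv_e: "inv_into S e k \<in> S" if "k < ?m" for k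
    using bij_betw_imp_surj_on[OF e] that by (intro inv_into_into) auto
  have "f j < ?m" if "j < L * ?m" for j
  proof -
    have "0 < ?m" using that by (cases "?m") auto
    then show ?thesis
      unfolding f_def by (auto intro!: e_less a inv_e simp: inv_into_into c(1))
  qed
  then obtain t where t: "t < ?m ^ (L * ?m)" "\<And>j. j < L * ?m \<Longrightarrow> t div ?m ^ j mod ?m = f j"
    using exists_digits[of "L * ?m" f ?m] by blast
  have "table_action ?m t (c l) (e s) = e (a l s)" if l: "l \<in> D" and s: "s \<in> S" for l s
  proof -
    let ?j = "c l * ?m + e s"
    have dm: "?j div ?m = c l" "?j mod ?m = e s" using e_less[OF s] by simp_all
    have "?j < Suc (c l) * ?m" using e_less[OF s] by simp
    also have "\<dots> \<le> L * ?m" using c(2)[OF l] by (intro mult_le_mono1) simp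
    finally have "table_action ?m t (c l) (e s) = f ?j" unfolding table_action_def by (rule t(2))
    also have "\<dots> = e (a l s)"
      unfolding f_def dm using l s c(1) e e_less[OF s] by (simp add: bij_betw_def)
    finally show ?thesis .
  qed
  with e t(1) show thesis by (rule that)
qed

lemma fold_transport:
  assumes "\<And>l s. l \<in> D \<Longrightarrow> s \<in> S \<Longrightarrow> a l s \<in> S \<and> b l (e s) = e (a l s)"
    and "set w \<subseteq> D" and "s \<in> S"
  shows "fold b w (e s) = e (fold a w s)"
  using assms(2,3) by (induction w arbitrary: s) (auto simp: assms(1))

definition run_table :: "nat \<Rightarrow> nat \<Rightarrow> nat \<Rightarrow> nat \<Rightarrow> nat"
  where "run_table m t w s = fold (\<lambda>l s. table_action m t l s) (list_decode w) s"

lemma run_table_word_code: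
  "run_table m t (word_code \<nu> w) s = fold (\<lambda>l. table_action m t (letter_code \<nu> l)) w s"
  by (simp add: run_table_def word_code_def fold_map comp_def)

text \<open>The condition that the program evaluates, with \<open>C\<close> the code of the list of defining relators and \<open>n\<close>
the code of an input: in no action on fewer than \<open>M\<close> points that satisfies the relators does \<open>g\<close> move a
point fixed by all \<open>h\<^sub>i\<close>. All quantifiers are bounded.\<close>

definition no_separating_table :: "nat \<Rightarrow> nat \<Rightarrow> nat \<Rightarrow> nat \<Rightarrow> bool"
  where "no_separating_table M L C n \<longleftrightarrow> (\<forall>m<M. \<forall>t<m ^ (L * m).
    (\<forall>r\<in>set (list_decode C). \<forall>s<m. run_table m t r s = s) \<longrightarrow>
    (\<forall>s<m. (\<forall>h\<in>set (list_decode (snd (prod_decode n))). run_table m t h s = s) \<longrightarrow>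
      run_table m t (fst (prod_decode n)) s = s))"

lemma length_le_list_encode: "length xs \<le> list_encode xs"
proof (induction xs)
  case (Cons x xs)
  then show ?case using le_prod_encode_2[of "list_encode xs" x] by simp
qed simp

lemma mem_le_list_encode: "x \<in> set xs \<Longrightarrow> x \<le> list_encode xs"
proof (induction xs)
  case (Cons y xs)
  then show ?case
    using le_prod_encode_2[of "list_encode xs" y] le_prod_encode_1[of y "list_encode xs"] by auto
qed simp

text \<open>The input code itself serves as the bound \<open>n\<close> in \<open>separating_letter_action\<close>.\<close>

lemma length_le_input_code:
  "length hs \<le> input_code \<nu> (g, hs)"
  "w \<in> set (g # hs) \<Longrightarrow> length w \<le> input_code \<nu> (g, hs)"
proof -
  let ?h = "list_encode (map (word_code \<nu>) hs)"
  have le: "word_code \<nu> g \<le> input_code \<nu> (g, hs)" "?h \<le> input_code \<nu> (g, hs)"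
    by (simp_all add: input_code_def le_prod_encode_1 le_prod_encode_2)
  show "length hs \<le> input_code \<nu> (g, hs)"
    using length_le_list_encode[of "map (word_code \<nu>) hs"] le(2) by simp
  assume "w \<in> set (g # hs)"
  then have "word_code \<nu> w \<le> input_code \<nu> (g, hs)"
    using le mem_le_list_encode[of "word_code \<nu> w" "map (word_code \<nu>) hs"] by auto
  moreover have "length w \<le> word_code \<nu> w"
    using length_le_list_encode[of "map (letter_code \<nu>) w"] by (simp add: word_code_def)
  ultimately show "length w \<le> input_code \<nu> (g, hs)" by simp
qed

context presented_amalgam
begin

text \<open>The separating action on a set of \<open>m\<close> points becomes a table after numbering the points. Conversely a table
that satisfies the relators is an action, in which membership forces \<open>g\<close> to fix every common fixed point
of the \<open>h\<^sub>i\<close>.\<close>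

lemma membership_iff_no_separating_table:
  assumes fin: "finite X" "finite R1" "finite R2" and \<nu>: "inj_on \<nu> X"
  obtains L C where "\<And>g hs. g \<in> words X \<Longrightarrow> set hs \<subseteq> words X \<Longrightarrow>
    word_class X R g \<in> generate (gp X R) (word_class X R ` set hs) \<longleftrightarrow>
    no_separating_table (Suc (degree_bound amalgam_size (input_code \<nu> (g, hs))))
      L C (input_code \<nu> (g, hs))"
proof -
  have fin_sX: "finite (signed X)" using fin(1) by (simp add: signed_def)
  then obtain L where L: "\<And>l. l \<in> signed X \<Longrightarrow> letter_code \<nu> l < L"
    using finite_nat_set_iff_bounded[of "letter_code \<nu> ` signed X"] by auto
  have inj: "inj_on (letter_code \<nu>) (signed X)"
  proof (rule inj_onI)
    fix k l assume "k \<in> signed X" "l \<in> signed X" "letter_code \<nu> k = letter_code \<nu> l"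
    then show "k = l"
      using inj_onD[OF \<nu>, of "fst k" "fst l"]
      by (auto simp: letter_code_def signed_def of_bool_def split: if_splits)
  qed
  \<comment> \<open>Tables need not consist of permutations, so the inverse law of the letters is checked like a relator.\<close>
  define Q where "Q = finite_relators \<union> (\<lambda>l. [l, inv_letter l]) ` signed X"
  have "finite Q" using fin A(2) fin_sX by (simp add: Q_def finite_relators_def)
  then obtain rs where rs: "set rs = Q" using finite_list by blast
  define C where "C = list_encode (map (word_code \<nu>) rs)"
  have Q_words: "Q \<subseteq> words X" using finite_relators_sub R_sub by (auto simp: Q_def)
  show thesis
  proof (rule that[of L C], rule iffI)
    fix g hs assume g: "g \<in> words X" and hs: "set hs \<subseteq> words X"
    let ?n = "input_code \<nu> (g, hs)"
    let ?M = "Suc (degree_bound amalgam_size ?n)"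
    let ?run = "\<lambda>m t. fold (\<lambda>l. table_action m t (letter_code \<nu> l))"
    have iff: "no_separating_table ?M L C ?n \<longleftrightarrow> (\<forall>m<?M. \<forall>t<m ^ (L * m).
      (\<forall>r\<in>Q. \<forall>s<m. ?run m t r s = s) \<longrightarrow>
      (\<forall>s<m. (\<forall>h\<in>set hs. ?run m t h s = s) \<longrightarrow> ?run m t g s = s))"
      by (simp add: no_separating_table_def C_def rs input_code_def
        run_table_word_code)
    {
      assume mem: "word_class X R g \<in> generate (gp X R) (word_class X R ` set hs)"
      show "no_separating_table ?M L C ?n"
        unfolding iff
      proof (intro allI impI)
        fix m t s
        assume rel: "\<forall>r\<in>Q. \<forall>s<m. ?run m t r s = s" and s: "s < m"
          and fix_hs: "\<forall>h\<in>set hs. ?run m t h s = s"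
        have "letter_action X finite_relators {..<m} (\<lambda>l. table_action m t (letter_code \<nu> l))"
          unfolding letter_action_def
        proof (intro conjI ballI)
          fix l s assume l: "l \<in> signed X" and s: "s \<in> {..<m}"
          then show "table_action m t (letter_code \<nu> l) s \<in> {..<m}" by (auto simp: table_action_def)
          have "[l, inv_letter l] \<in> Q" using l by (simp add: Q_def)
          from rel[rule_format, OF this, of s] s
          show "table_action m t (letter_code \<nu> (inv_letter l)) (table_action m t (letter_code \<nu> l) s) = s"
            by simp
        qed (use rel in \<open>auto simp: Q_def\<close>)
        from letter_action_generate[OF R_sub letter_action_finite_relators[OF this] _ hs _ g mem]
        show "?run m t g s = s" using s fix_hs by simp
      qed
    next
      assume no_table: "no_separating_table ?M L C ?n"
      show "word_class X R g \<in> generate (gp X R) (word_class X R ` set hs)"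
      proof (rule ccontr)
        assume notin: "word_class X R g \<notin> generate (gp X R) (word_class X R ` set hs)"
        obtain Z :: "(bool \<times> ('x word set set \<times> 'x word set \<times> 'x word set) set) set" and b z
          where Z: "letter_action X R Z b" "finite Z"
            "card Z \<le> degree_bound amalgam_size ?n" and z: "z \<in> Z"
            and bh: "\<And>h. h \<in> set hs \<Longrightarrow> fold b h z = z" and bg: "fold b g z \<noteq> z"
          by (rule separating_letter_action[OF g hs notin length_le_input_code], assumption, rule that)
        have m: "card Z < ?M" using Z(3) by (rule le_imp_less_Suc)
        have b_closed: "b l s \<in> Z" if "l \<in> signed X" "s \<in> Z" for l s
          using Z(1) that by (simp add: letter_action_def)
        obtain e t where e: "bij_betw e Z {..<card Z}" and t: "t < card Z ^ (L * card Z)"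
          and te: "\<And>l s. l \<in> signed X \<Longrightarrow> s \<in> Z \<Longrightarrow>
            table_action (card Z) t (letter_code \<nu> l) (e s) = e (b l s)"
          by (rule exists_table_action[OF inj L Z(2) b_closed], assumption+, rule that)
        have run: "?run (card Z) t w (e s) = e (fold b w s)" if "w \<in> words X" "s \<in> Z" for w s
          by (rule fold_transport[of "signed X" Z]) (use that te b_closed in \<open>auto simp: words_def\<close>)
        have "?run (card Z) t r s = s" if r: "r \<in> Q" and s: "s < card Z" for r s
        proof -
          have "s \<in> e ` Z" using e s by (simp add: bij_betw_def)
          then obtain y where y: "y \<in> Z" "s = e y" by blast
          have "fold b r y = y"
            using r Z(1) y(1) finite_relators_sub by (auto simp: Q_def letter_action_def)
          then show ?thesis using run[OF _ y(1), of r] r Q_words y(2) by auto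
        qed
        moreover have "e z < card Z" using e z by (auto simp: bij_betw_def)
        moreover have "?run (card Z) t h (e z) = e z" if "h \<in> set hs" for h
          using run[OF _ z, of h] bh[OF that] hs that by auto
        ultimately have "?run (card Z) t g (e z) = e z"
          using no_table[unfolded iff, rule_format, OF m t] by simp
        then have "e (fold b g z) = e z" using run[OF g z] by simp
        then show False
          using bg z letter_action_closed[OF Z(1) g z] e by (auto simp: bij_betw_def dest: inj_onD)
      qed
    }
  qed
qed

end

section \<open>Computable functions\<close>

text \<open>Closure properties of computable functions are easiest to use for functions of named variables. An
environment is a nested tuple \<open>(x\<^sub>1, (x\<^sub>2, \<dots>))\<close> of numbers that holds the values of the variables; the
argument list of a program is the flattened tuple. Its length depends on the type only, as the
projections in a composition have to be fixed in advance.\<close>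

class env =
  fixes env_list :: "'a \<Rightarrow> nat list"
  assumes env_length: "\<exists>k. \<forall>e. length (env_list e) = k"

instantiation nat :: env
begin
definition env_list_nat :: "nat \<Rightarrow> nat list" where "env_list_nat n = [n]"
instance by standard (simp add: env_list_nat_def)
end

instantiation prod :: (env, env) env
begin
definition env_list_prod :: "'a \<times> 'b \<Rightarrow> nat list"
  where "env_list_prod e = env_list (fst e) @ env_list (snd e)"
instance
proof
  obtain k where "\<forall>e::'a. length (env_list e) = k" using env_length[where 'a = 'a] ..
  moreover obtain l where "\<forall>e::'b. length (env_list e) = l" using env_length[where 'a = 'b] ..
  ultimately show "\<exists>k. \<forall>e::'a \<times> 'b. length (env_list e) = k"
    by (simp add: env_list_prod_def)
qed
end

lemma env_list_Pair [simp]: "env_list (n, e) = n # env_list e" for n :: nat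
  by (simp add: env_list_prod_def env_list_nat_def)

definition computable :: "('e::env \<Rightarrow> nat) \<Rightarrow> bool"
  where "computable f \<longleftrightarrow> (\<exists>p. \<forall>e. evals p (env_list e) (f e))"

text \<open>Computable changes of environment make weakening and substitution instances of one composition
lemma, \<open>computable_comp\<close>.\<close>

definition computable_map :: "('d::env \<Rightarrow> 'e::env) \<Rightarrow> bool"
  where "computable_map \<pi> \<longleftrightarrow> (\<exists>ps. \<forall>d. length ps = length (env_list (\<pi> d)) \<and>
    (\<forall>i<length ps. evals (ps ! i) (env_list d) (env_list (\<pi> d) ! i)))"

named_theorems computable_intros

lemma computable_map_id [computable_intros]: "computable_map (\<lambda>d :: 'd::env. d)"
proof -
  obtain k where k: "\<And>d :: 'd. length (env_list d) = k" using env_length[where 'a = 'd] by blast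
  show ?thesis
    unfolding computable_map_def
  proof (intro exI allI conjI impI)
    show "length (map Proj [0..<k]) = length (env_list d)" for d :: 'd by (simp add: k)
    show "evals (map Proj [0..<k] ! i) (env_list d) (env_list d ! i)"
      if "i < length (map Proj [0..<k])" for d :: 'd and i
      using that evals.Proj[of i "env_list d"] by (simp add: k)
  qed
qed

lemma computable_map_snd [computable_intros]:
  fixes \<pi> :: "'d::env \<Rightarrow> nat \<times> 'e::env"
  assumes "computable_map \<pi>"
  shows "computable_map (\<lambda>d. snd (\<pi> d))"
proof -
  obtain ps where ps: "\<And>d. length ps = length (env_list (\<pi> d))"
    "\<And>d i. i < length ps \<Longrightarrow> evals (ps ! i) (env_list d) (env_list (\<pi> d) ! i)"
    using assms unfolding computable_map_def by blast
  have split: "env_list (\<pi> d) = fst (\<pi> d) # env_list (snd (\<pi> d))" for d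
    by (metis env_list_Pair prod.collapse)
  show ?thesis
    unfolding computable_map_def
  proof (intro exI allI conjI impI)
    show "length (tl ps) = length (env_list (snd (\<pi> d)))" for d
      using ps(1)[of d] by (simp add: split)
    show "evals (tl ps ! i) (env_list d) (env_list (snd (\<pi> d)) ! i)" if "i < length (tl ps)" for d i
      using ps(2)[of "Suc i" d] that by (simp add: split nth_tl)
  qed
qed

lemma computable_fst [computable_intros]:
  fixes \<pi> :: "'d::env \<Rightarrow> nat \<times> 'e::env"
  assumes "computable_map \<pi>"
  shows "computable (\<lambda>d. fst (\<pi> d))"
proof -
  obtain ps where ps: "\<And>d. length ps = length (env_list (\<pi> d))"
    "\<And>d i. i < length ps \<Longrightarrow> evals (ps ! i) (env_list d) (env_list (\<pi> d) ! i)"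
    using assms unfolding computable_map_def by blast
  have split: "env_list (\<pi> d) = fst (\<pi> d) # env_list (snd (\<pi> d))" for d
    by (metis env_list_Pair prod.collapse)
  have "evals (ps ! 0) (env_list d) (fst (\<pi> d))" for d
    using ps(1)[of d] ps(2)[of 0 d] by (simp add: split)
  then show ?thesis unfolding computable_def by blast
qed

lemma computable_map_Pair [computable_intros]:
  assumes "computable f" and "computable_map \<pi>"
  shows "computable_map (\<lambda>d. (f d, \<pi> d))"
proof -
  obtain p where p: "\<And>d. evals p (env_list d) (f d)" using assms(1) unfolding computable_def by blast
  obtain ps where ps: "\<And>d. length ps = length (env_list (\<pi> d))"
    "\<And>d i. i < length ps \<Longrightarrow> evals (ps ! i) (env_list d) (env_list (\<pi> d) ! i)"
    using assms(2) unfolding computable_map_def by blast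
  show ?thesis
    unfolding computable_map_def
  proof (intro exI allI conjI impI)
    show "length (p # ps) = length (env_list (f d, \<pi> d))" for d using ps(1)[of d] by simp
    show "evals ((p # ps) ! i) (env_list d) (env_list (f d, \<pi> d) ! i)"
      if "i < length (p # ps)" for d i
      using that p ps(2) by (auto simp: less_Suc_eq_0_disj)
  qed
qed

lemma computable_comp:
  assumes "computable f" and "computable_map \<pi>"
  shows "computable (\<lambda>d. f (\<pi> d))"
proof -
  obtain p where p: "\<And>e. evals p (env_list e) (f e)" using assms(1) unfolding computable_def by blast
  obtain ps where ps: "\<And>d. length ps = length (env_list (\<pi> d))"
    "\<And>d i. i < length ps \<Longrightarrow> evals (ps ! i) (env_list d) (env_list (\<pi> d) ! i)"
    using assms(2) unfolding computable_map_def by blast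
  have "evals (Comp p ps) (env_list d) (f (\<pi> d))" for d
  proof (rule evals.Comp)
    show "length (env_list (\<pi> d)) = length ps" using ps(1) by simp
    show "\<forall>i<length ps. evals (ps ! i) (env_list d) (env_list (\<pi> d) ! i)" using ps(2) by blast
    show "evals p (env_list (\<pi> d)) (f (\<pi> d))" by (rule p)
  qed
  then show ?thesis unfolding computable_def by blast
qed

text \<open>Bodies of bounded sums and recursions are functions of bound variables and an environment. The next
two lemmas substitute for the bound variables while the environment changes; unification needs them
in this curried form.\<close>

lemma computable_comp2:
  assumes "computable (\<lambda>q. f (fst q) (snd q))" and "computable g" and "computable_map \<pi>"
  shows "computable (\<lambda>d. f (g d) (\<pi> d))"
  using computable_comp[OF assms(1) computable_map_Pair[OF assms(2,3)]] by simp

lemma computable_comp3: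
  assumes "computable (\<lambda>q. f (fst q) (fst (snd q)) (snd (snd q)))"
    and "computable g" and "computable h" and "computable_map \<pi>"
  shows "computable (\<lambda>d. f (g d) (h d) (\<pi> d))"
  using computable_comp[OF assms(1) computable_map_Pair[OF assms(2) computable_map_Pair[OF assms(3,4)]]]
  by simp

lemma computable_id [computable_intros]: "computable (\<lambda>n :: nat. n)"
proof -
  have "evals (Proj 0) (env_list n) n" for n :: nat
    using evals.Proj[of 0 "env_list n"] by (simp add: env_list_nat_def)
  then show ?thesis unfolding computable_def by blast
qed

text \<open>The last component of an environment is a bare number, so that unary functions of type
\<^typ>\<open>nat \<Rightarrow> nat\<close> are included; this rule reads it.\<close>

lemma computable_snd [computable_intros]:
  fixes \<pi> :: "'d::env \<Rightarrow> nat \<times> nat"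
  assumes "computable_map \<pi>"
  shows "computable (\<lambda>d. snd (\<pi> d))"
  using computable_id computable_map_snd[OF assms] by (rule computable_comp)

lemma computable_Suc [computable_intros]:
  assumes "computable f" shows "computable (\<lambda>e. Suc (f e))"
proof -
  have "computable Suc"
    unfolding computable_def env_list_nat_def using evals.Succ by blast
  moreover have "computable_map f"
  proof -
    obtain p where p: "\<And>e. evals p (env_list e) (f e)" using assms unfolding computable_def by blast
    show ?thesis
      unfolding computable_map_def by (rule exI[of _ "[p]"]) (simp add: env_list_nat_def p)
  qed
  ultimately show ?thesis by (rule computable_comp)
qed

lemma computable_const [computable_intros]: "computable (\<lambda>e. c)"
proof (induction c)
  case 0
  show ?case unfolding computable_def using evals.Zero by blast
next
  case (Suc c)
  then show ?case by (rule computable_Suc)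
qed

text \<open>Primitive recursion with parameters, in the form in which the recursion combinator of the natural
numbers appears in terms. The arithmetic operations and the bounded quantifiers are derived from it.\<close>

lemma computable_rec_nat [computable_intros]:
  fixes b c :: "'e::env \<Rightarrow> nat"
  assumes b: "computable b" and h: "computable (\<lambda>q. h (fst q) (fst (snd q)) (snd (snd q)))"
    and c: "computable c"
  shows "computable (\<lambda>e. rec_nat (b e) (\<lambda>n y. h n y e) (c e))"
proof -
  obtain p where p: "\<And>e. evals p (env_list e) (b e)" using b unfolding computable_def by blast
  obtain r where r: "\<And>q. evals r (env_list q) (h (fst q) (fst (snd q)) (snd (snd q)))"
    using h unfolding computable_def by blast
  have "evals (PrimRec p r) (env_list (n, e)) (rec_nat (b e) (\<lambda>n y. h n y e) n)" for n e
  proof (induction n)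
    case 0
    show ?case by (simp add: evals.PrimRec_0 p)
  next
    case (Suc n)
    then show ?case
      using r[of "(n, rec_nat (b e) (\<lambda>n y. h n y e) n, e)"] by (auto intro: evals.PrimRec_Suc)
  qed
  then have "computable (\<lambda>q :: nat \<times> 'e. rec_nat (b (snd q)) (\<lambda>n y. h n y (snd q)) (fst q))"
    unfolding computable_def by (metis prod.collapse)
  then show ?thesis using c computable_map_id by (rule computable_comp2)
qed

lemma computable_add [computable_intros]:
  assumes "computable f" and "computable g" shows "computable (\<lambda>e. f e + g e)"
proof -
  have eq: "rec_nat a (\<lambda>n y. Suc y) b = a + b" for a b :: nat by (induction b) auto
  have "computable (\<lambda>e. rec_nat (f e) (\<lambda>n y. Suc y) (g e))"
    by (intro computable_intros assms)
  then show ?thesis unfolding eq .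
qed

lemma computable_mult [computable_intros]:
  assumes "computable f" and "computable g" shows "computable (\<lambda>e. f e * g e)"
proof -
  have eq: "rec_nat 0 (\<lambda>n y. y + a) b = a * b" for a b :: nat by (induction b) auto
  have "computable (\<lambda>e. rec_nat 0 (\<lambda>n y. y + f e) (g e))"
    by (intro computable_intros assms computable_comp[OF assms(1)])
  then show ?thesis unfolding eq .
qed

lemma computable_power [computable_intros]:
  assumes "computable f" and "computable g" shows "computable (\<lambda>e. f e ^ g e)"
proof -
  have eq: "rec_nat 1 (\<lambda>n y. a * y) b = a ^ b" for a b :: nat by (induction b) auto
  have "computable (\<lambda>e. rec_nat 1 (\<lambda>n y. f e * y) (g e))"
    by (intro computable_intros assms computable_comp[OF assms(1)])
  then show ?thesis unfolding eq .
qed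

lemma computable_diff [computable_intros]:
  assumes "computable f" and "computable g" shows "computable (\<lambda>e. f e - g e)"
proof -
  have pred: "rec_nat 0 (\<lambda>n y. n) a = a - 1" for a :: nat by (cases a) auto
  have eq: "rec_nat a (\<lambda>n y. rec_nat 0 (\<lambda>n y. n) y) b = a - b" for a b :: nat
    by (induction b) (auto simp: pred)
  have "computable (\<lambda>e. rec_nat (f e) (\<lambda>n y. rec_nat 0 (\<lambda>n y. n) y) (g e))"
    by (intro computable_intros assms)
  then show ?thesis unfolding eq .
qed

lemma computable_sum [computable_intros]:
  assumes "computable (\<lambda>q. f (fst q) (snd q))" and "computable c"
  shows "computable (\<lambda>e. \<Sum>n<c e. f n e)"
proof -
  have eq: "rec_nat 0 (\<lambda>n y. y + f n e) b = (\<Sum>n<b. f n e)" for b :: nat and e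
    by (induction b) auto
  have "computable (\<lambda>e. rec_nat 0 (\<lambda>n y. y + f n e) (c e))"
    by (intro computable_intros assms computable_comp2[OF assms(1)])
  then show ?thesis unfolding eq .
qed

abbreviation decidable :: "('e::env \<Rightarrow> bool) \<Rightarrow> bool"
  where "decidable P \<equiv> computable (\<lambda>e. of_bool (P e))"

lemma decidable_le [computable_intros]:
  assumes "computable f" and "computable g" shows "decidable (\<lambda>e. f e \<le> g e)"
proof -
  have "computable (\<lambda>e. 1 - (f e - g e))" by (intro computable_intros assms)
  moreover have "1 - (f e - g e) = of_bool (f e \<le> g e)" for e by simp
  ultimately show ?thesis by simp
qed

lemma decidable_not [computable_intros]:
  assumes "decidable P" shows "decidable (\<lambda>e. \<not> P e)"
proof -
  have "computable (\<lambda>e. 1 - of_bool (P e))" by (intro computable_intros assms)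
  moreover have "1 - of_bool (P e) = (of_bool (\<not> P e) :: nat)" for e by simp
  ultimately show ?thesis by simp
qed

lemma decidable_conj [computable_intros]:
  assumes "decidable P" and "decidable Q" shows "decidable (\<lambda>e. P e \<and> Q e)"
  using computable_mult[OF assms] by (simp add: of_bool_conj)

lemma decidable_imp [computable_intros]:
  assumes "decidable P" and "decidable Q" shows "decidable (\<lambda>e. P e \<longrightarrow> Q e)"
proof -
  have "decidable (\<lambda>e. \<not> (P e \<and> \<not> Q e))" by (intro computable_intros assms)
  then show ?thesis by simp
qed

lemma decidable_eq [computable_intros]:
  assumes "computable f" and "computable g" shows "decidable (\<lambda>e. f e = g e)"
proof -
  have "decidable (\<lambda>e. f e \<le> g e \<and> g e \<le> f e)" by (intro computable_intros assms)
  then show ?thesis by (simp add: order_eq_iff)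
qed

lemma decidable_less [computable_intros]:
  assumes "computable f" and "computable g" shows "decidable (\<lambda>e. f e < g e)"
  using decidable_le[OF computable_Suc[OF assms(1)] assms(2)] by (simp add: Suc_le_eq)

lemma decidable_all_less [computable_intros]:
  assumes "decidable (\<lambda>q. P (fst q) (snd q))" and "computable c"
  shows "decidable (\<lambda>e. \<forall>n<c e. P n e)"
proof -
  have "decidable (\<lambda>e. (\<Sum>n<c e. of_bool (\<not> P n e)) = (0::nat))"
    by (intro computable_intros assms)
  moreover have "(\<Sum>n<c e. of_bool (\<not> P n e)) = (0::nat) \<longleftrightarrow> (\<forall>n<c e. P n e)" for e
    by (auto simp: sum_eq_0_iff)
  ultimately show ?thesis by simp
qed

lemma computable_if [computable_intros]:
  assumes "decidable P" and "computable f" and "computable g"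
  shows "computable (\<lambda>e. if P e then f e else g e)"
proof -
  have "computable (\<lambda>e. of_bool (P e) * f e + of_bool (\<not> P e) * g e)"
    by (intro computable_intros assms)
  moreover have "of_bool (P e) * f e + of_bool (\<not> P e) * g e = (if P e then f e else g e)" for e
    by simp
  ultimately show ?thesis by simp
qed

text \<open>The quotient \<open>a div b\<close> counts the \<open>q < a\<close> with \<open>(q + 1) b \<le> a\<close>; for \<open>b = 0\<close> the guard makes the count
\<open>0\<close>, the value of \<open>a div 0\<close>.\<close>

lemma computable_div [computable_intros]:
  assumes "computable f" and "computable g" shows "computable (\<lambda>e. f e div g e)"
proof -
  have eq: "(\<Sum>q<a. of_bool (0 < b \<and> Suc q * b \<le> a)) = a div b" for a b :: nat
  proof (cases "b = 0")
    case False
    then have "{q. q < a \<and> Suc q * b \<le> a} = {q. q < a \<and> q < a div b}"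
      by (metis Suc_le_eq gr0I less_eq_div_iff_mult_less_eq)
    also have "\<dots> = {..<a div b}" by (auto intro: less_le_trans)
    finally show ?thesis
      using False by (simp add: sum.If_cases of_bool_def Int_def)
  qed auto
  have "computable (\<lambda>e. \<Sum>q<f e. of_bool (0 < g e \<and> Suc q * g e \<le> f e))"
    by (intro computable_intros assms computable_comp[OF assms(1)] computable_comp[OF assms(2)])
  then show ?thesis unfolding eq .
qed

lemma computable_mod [computable_intros]:
  assumes "computable f" and "computable g" shows "computable (\<lambda>e. f e mod g e)"
proof -
  have "computable (\<lambda>e. f e - f e div g e * g e)" by (intro computable_intros assms)
  then show ?thesis by (simp add: minus_div_mult_eq_mod)
qed

lemma computable_prod_encode [computable_intros]:
  assumes "computable f" and "computable g" shows "computable (\<lambda>e. prod_encode (f e, g e))"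
proof -
  have "computable (\<lambda>e. ((f e + g e) * Suc (f e + g e)) div 2 + f e)"
    by (intro computable_intros assms)
  then show ?thesis by (simp add: prod_encode_def triangle_def)
qed

text \<open>Decoding of pairs by exhaustive search: both components are bounded by the code, and a sum in which
only one term survives returns any function of them.\<close>

lemma sum_prod_decode:
  "(\<Sum>a<Suc n. \<Sum>b<Suc n. if prod_encode (a, b) = n then h a b else 0) =
    (h (fst (prod_decode n)) (snd (prod_decode n)) :: nat)"
proof -
  let ?a = "fst (prod_decode n)" and ?b = "snd (prod_decode n)"
  have iff: "prod_encode (a, b) = n \<longleftrightarrow> a = ?a \<and> b = ?b" for a b
    by (metis fst_conv prod.collapse prod_decode_inverse prod_encode_inverse snd_conv)
  have le: "?a < Suc n" "?b < Suc n"
    using le_prod_encode_1[of ?a ?b] le_prod_encode_2[of ?b ?a] by (simp_all add: less_Suc_eq_le)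
  have "(\<Sum>b<Suc n. if prod_encode (a, b) = n then h a b else 0) = (if a = ?a then h ?a ?b else 0)" for a
    using le(2) by (simp only: iff) (auto simp: sum.delta' simp del: sum.lessThan_Suc)
  then show ?thesis using le(1) by (simp add: sum.delta' del: sum.lessThan_Suc)
qed

text \<open>Constants for the two components, because the term \<open>fst (prod_decode n)\<close> would also match the rule
\<open>computable_fst\<close> for reading a variable of the environment.\<close>

definition decode_fst :: "nat \<Rightarrow> nat" where "decode_fst n = fst (prod_decode n)"

definition decode_snd :: "nat \<Rightarrow> nat" where "decode_snd n = snd (prod_decode n)"

lemma computable_decode_fst [computable_intros]:
  assumes "computable f" shows "computable (\<lambda>e. decode_fst (f e))"
proof -
  have "computable (\<lambda>e. \<Sum>a<Suc (f e). \<Sum>b<Suc (f e). if prod_encode (a, b) = f e then a else 0)"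
    by (intro computable_intros assms computable_comp[OF assms])
  then show ?thesis by (simp only: sum_prod_decode decode_fst_def decode_snd_def)
qed

lemma computable_decode_snd [computable_intros]:
  assumes "computable f" shows "computable (\<lambda>e. decode_snd (f e))"
proof -
  have "computable (\<lambda>e. \<Sum>a<Suc (f e). \<Sum>b<Suc (f e). if prod_encode (a, b) = f e then b else 0)"
    by (intro computable_intros assms computable_comp[OF assms])
  then show ?thesis by (simp only: sum_prod_decode decode_fst_def decode_snd_def)
qed

lemma list_decode_step:
  "list_decode n = (if n = 0 then [] else
    decode_fst (n - 1) # list_decode (decode_snd (n - 1)))"
  by (cases n) (auto simp: decode_fst_def decode_snd_def split: prod.split)

lemma list_encode_drop:
  "rec_nat n (\<lambda>i y. decode_snd (y - 1)) i = list_encode (drop i (list_decode n))"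
proof (induction i)
  case (Suc i)
  have "decode_snd (m - 1) = list_encode (tl (list_decode m))" for m
    by (subst list_decode_step) (auto simp: prod_decode_def prod_decode_aux.simps decode_snd_def)
  with Suc show ?case by (simp add: drop_Suc drop_tl)
qed simp

lemma computable_list_encode_drop [computable_intros]:
  assumes "computable f" and "computable g"
  shows "computable (\<lambda>e. list_encode (drop (g e) (list_decode (f e))))"
proof -
  have "computable (\<lambda>e. rec_nat (f e) (\<lambda>i y. decode_snd (y - 1)) (g e))"
    by (intro computable_intros assms)
  then show ?thesis by (simp only: list_encode_drop)
qed

text \<open>A loop over a coded list: the \<open>i\<close>-th round of a primitive recursion processes the head of the list
with \<open>i\<close> entries dropped. The code of a list bounds its length, so as many rounds as the code suffice,
and the rounds after the end of the list do nothing.\<close>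

lemma computable_fold_list_decode [computable_intros]:
  assumes w: "computable w" and s: "computable s"
    and f: "computable (\<lambda>q. f (fst q) (fst (snd q)) (snd (snd q)))"
  shows "computable (\<lambda>e. fold (\<lambda>x y. f x y e) (list_decode (w e)) (s e))"
proof -
  let ?d = "\<lambda>i e. list_encode (drop i (list_decode (w e)))"
  let ?h = "\<lambda>i y e. if ?d i e = 0 then y else f (decode_fst (?d i e - 1)) y e"
  have "rec_nat (s e) (\<lambda>i y. ?h i y e) i = fold (\<lambda>x y. f x y e) (take i (list_decode (w e))) (s e)"
    for i e
  proof (induction i)
    case (Suc i)
    show ?case
    proof (cases "i < length (list_decode (w e))")
      case True
      then have "drop i (list_decode (w e)) =
          list_decode (w e) ! i # drop (Suc i) (list_decode (w e))"
        by (rule Cons_nth_drop_Suc[symmetric])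
      then show ?thesis using Suc True by (simp add: take_Suc_conv_app_nth decode_fst_def)
    qed (use Suc in simp)
  qed simp
  moreover have "length (list_decode (w e)) \<le> w e" for e
    using length_le_list_encode[of "list_decode (w e)"] by simp
  ultimately have "rec_nat (s e) (\<lambda>i y. ?h i y e) (w e) = fold (\<lambda>x y. f x y e) (list_decode (w e)) (s e)" for e
    by simp
  moreover have "computable (\<lambda>e. rec_nat (s e) (\<lambda>i y. ?h i y e) (w e))"
    by (intro computable_intros assms computable_comp[OF w] computable_comp3[OF f])
  ultimately show ?thesis by simp
qed

text \<open>The conjunction is a loop whose state is a truth value, multiplied by the next one in each round.\<close>

lemma decidable_all_list_decode [computable_intros]:
  assumes "decidable (\<lambda>q. P (fst q) (snd q))" and "computable c"
  shows "decidable (\<lambda>e. \<forall>x\<in>set (list_decode (c e)). P x e)"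
proof -
  have "fold (\<lambda>x y. of_bool (P x e) * y) xs b = of_bool (\<forall>x\<in>set xs. P x e) * b"
    for xs e and b :: nat
    by (induction xs arbitrary: b) auto
  moreover have "computable (\<lambda>e. fold (\<lambda>x y. of_bool (P x e) * y) (list_decode (c e)) 1)"
    by (intro computable_intros assms computable_comp2[OF assms(1)])
  ultimately show ?thesis by simp
qed

section \<open>Deciding membership\<close>

lemma computable_table_action [computable_intros]:
  assumes "computable m" and "computable t" and "computable l" and "computable s"
  shows "computable (\<lambda>e. table_action (m e) (t e) (l e) (s e))"
  unfolding table_action_def by (intro computable_intros assms)

lemma computable_run_table [computable_intros]:
  assumes "computable m" and "computable t" and "computable w" and "computable s"
  shows "computable (\<lambda>e. run_table (m e) (t e) (w e) (s e))"
  unfolding run_table_def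
  by (intro computable_intros assms computable_comp[OF assms(1)] computable_comp[OF assms(2)])

lemma decidable_no_separating_table:
  assumes "computable M"
  shows "decidable (\<lambda>n. no_separating_table (M n) L C n)"
  unfolding no_separating_table_def decode_fst_def[symmetric] decode_snd_def[symmetric]
  by (intro computable_intros assms)

lemma computable_nat_iff: "computable (f :: nat \<Rightarrow> nat) \<longleftrightarrow> (\<exists>p. \<forall>n. evals p [n] (f n))"
  by (simp add: computable_def env_list_nat_def)

theorem corollary9p1:
  fixes X\<^sub>1 X\<^sub>2 :: "'x set" and R\<^sub>1 R\<^sub>2 :: "'x word set"
    and A :: "('a, 'm) monoid_scheme" and \<phi>\<^sub>1 \<phi>\<^sub>2 :: "'a \<Rightarrow> 'x word set"
    and \<nu> :: "'x \<Rightarrow> nat"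
  defines "X \<equiv> X\<^sub>1 \<union> X\<^sub>2"
    and "R \<equiv> amalgam_relators R\<^sub>1 R\<^sub>2 A \<phi>\<^sub>1 \<phi>\<^sub>2"
  assumes "finite X\<^sub>1" and "finite R\<^sub>1" and "R\<^sub>1 \<subseteq> words X\<^sub>1" and "finite (carrier (gp X\<^sub>1 R\<^sub>1))"
    and "finite X\<^sub>2" and "finite R\<^sub>2" and "R\<^sub>2 \<subseteq> words X\<^sub>2" and "finite (carrier (gp X\<^sub>2 R\<^sub>2))"
    and "signed X\<^sub>1 \<inter> signed X\<^sub>2 = {}"
    and "group A" and "finite (carrier A)"
    and "\<phi>\<^sub>1 \<in> mon A (gp X\<^sub>1 R\<^sub>1)" and "\<phi>\<^sub>2 \<in> mon A (gp X\<^sub>2 R\<^sub>2)"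
    and "inj_on \<nu> (X\<^sub>1 \<union> X\<^sub>2)"
  shows "\<exists>p. decides p (input_code \<nu>) {(g, hs). g \<in> words X \<and> set hs \<subseteq> words X}
    (\<lambda>(g, hs). word_class X R g \<in> generate (gp X R) (word_class X R ` set hs))"
proof -
  have amalgam: "presented_amalgam X\<^sub>1 X\<^sub>2 R\<^sub>1 R\<^sub>2 A \<phi>\<^sub>1 \<phi>\<^sub>2"
    using assms(3-) by (simp add: presented_amalgam_def)
  have fin: "finite (X\<^sub>1 \<union> X\<^sub>2)" using assms by simp
  let ?bound = "degree_bound (presented_amalgam.amalgam_size X\<^sub>1 X\<^sub>2 R\<^sub>1 R\<^sub>2 A)"
  obtain L C where LC: "\<And>g hs. g \<in> words X \<Longrightarrow> set hs \<subseteq> words X \<Longrightarrow>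
    word_class X R g \<in> generate (gp X R) (word_class X R ` set hs) \<longleftrightarrow>
    no_separating_table (Suc (?bound (input_code \<nu> (g, hs)))) L C (input_code \<nu> (g, hs))"
    by (rule presented_amalgam.membership_iff_no_separating_table[OF amalgam fin \<open>finite R\<^sub>1\<close>
      \<open>finite R\<^sub>2\<close> \<open>inj_on \<nu> (X\<^sub>1 \<union> X\<^sub>2)\<close>, folded X_def R_def], rule that)
  have "decidable (\<lambda>n. no_separating_table (Suc (?bound n)) L C n)"
    unfolding degree_bound_def by (intro decidable_no_separating_table computable_intros)
  then obtain p where "\<And>n. evals p [n] (of_bool (no_separating_table (Suc (?bound n)) L C n))"
    unfolding computable_nat_iff by blast
  then show ?thesis
    unfolding decides_def using LC by (intro exI[of _ p]) (auto simp: of_bool_def)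
qed

end
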